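(* Fix relatively prime integers $a,b$ with $b>0$, and for $j\in\mathbb{N}$ let $\alpha_j\in(0,2)$ be such that $\cot\frac{\pi\alpha_j}{2}=\frac{a+jb}{b}$. Let $S(X)=\int_0^Xe^{\pi \mathrm{i}x^2}\,dx$. Then for every positive integer $N$, $$\lim_{j\to\infty}\ \sup_{X\in[0,\,j^{-1/(2N)}]}\left|\Pi_{\alpha_j}(X)-e^{-\frac{\pi \mathrm{i}}{4}}S(j^{1/2}X)\right|=0.$$
   Context: $Ш_1=\sum_{k\in\mathbb{Z}}\delta(x-k)\in\mathscr{S}'(\mathbb{R})$ is the Dirac comb. For $\alpha\in(0,2)$ the fractional Fourier transform is $$\mathcal{F}^\alpha f(x) = \frac{1}{\sqrt{\mathrm{i}\sin(\pi\alpha/2)}}\int e^{\frac{\pi \mathrm{i}}{\sin(\pi\alpha/2)}(\cos(\pi\alpha/2)(x^2+y^2)-2xy)}f(y)\,dy$$ (square root with positive real part), an automorphism of $\mathscr{S}(\mathbb{R})$ extended to $\mathscr{S}'(\mathbb{R})$. When $\cos\frac{\pi\alpha}{2}$ and $\sin\frac{\pi\alpha}{2}$ are linearly dependent over $\mathbb{Z}$ (as holds for every $\alpha_j$), $\mathcal{F}^\alphaШ_1$ is a locally finite complex measure supported on a discrete set (a series of complex multiples of delta functions), and its antiderivative is defined for $X>0$ by $$\Pi_\alpha(X)=\frac12\left(\int_{[0,X]}\mathcal{F}^\alphaШ_1(x)\,dx+\int_{(0,X)}\mathcal{F}^\alphaШ_1(x)\,dx\right),$$ where the integrals denote the mass the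 measure gives to the closed and open intervals; $\Pi_\alpha$ is extended to be an odd function, so $\Pi_\alpha(0)=0$. *)

theory Defs
  imports "HOL-Analysis.Analysis"
begin

definition iter_deriv :: "nat \<Rightarrow> (real \<Rightarrow> complex) \<Rightarrow> real \<Rightarrow> complex" where
  "iter_deriv n f = ((\<lambda>g x. vector_derivative g (at x)) ^^ n) f"

definition schwartz :: "(real \<Rightarrow> complex) \<Rightarrow> bool" where
  "schwartz f \<longleftrightarrow>
     (\<forall>n x. iter_deriv n f differentiable (at x)) \<and>
     (\<forall>k n. bounded (range (\<lambda>x. x ^ k *\<^sub>R iter_deriv n f x)))"

definition frft :: "real \<Rightarrow> (real \<Rightarrow> complex) \<Rightarrow> real \<Rightarrow> complex" where
  "frft \<alpha> f x =
     1 / csqrt (\<i> * of_real (sin (pi * \<alpha> / 2))) *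
     (LINT y|lborel.
        exp (of_real pi * \<i> / of_real (sin (pi * \<alpha> / 2)) *
             of_real (cos (pi * \<alpha> / 2) * (x\<^sup>2 + y\<^sup>2) - 2 * x * y)) * f y)"

text \<open>
  Tempered distributions are represented by functionals on functions; only their values on
  Schwartz functions matter.  The kernel of \<^const>\<open>frft\<close> is symmetric in \<open>x\<close> and \<open>y\<close>, so that
  \<open>\<integral> (frft \<alpha> f) g = \<integral> f (frft \<alpha> g)\<close> for Schwartz functions (without complex conjugation); the
  extension to distributions is therefore by transposition with the same operator.
\<close>

type_synonym distribution = "(real \<Rightarrow> complex) \<Rightarrow> complex"

definition dirac_comb :: distribution where
  "dirac_comb \<phi> = (\<Sum>\<^sub>\<infinity>k::int. \<phi> (of_int k))"

definition frft_distr :: "real \<Rightarrow> distribution \<Rightarrow> distribution" where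
  "frft_distr \<alpha> T \<phi> = T (frft \<alpha> \<phi>)"

text \<open>
  A locally finite complex measure with discrete (closed) support is encoded by the function
  \<open>w\<close> giving the mass of each point, that is, as the series of the \<open>w x\<close>-multiples of the delta
  functions at \<open>x\<close>.  The second conjunct says that this series is \<open>T\<close> as a tempered distribution.
  Since \<open>T\<close> determines \<open>w\<close>, the definite description below denotes whenever \<open>T\<close> is such a measure.
\<close>

definition is_delta_series :: "distribution \<Rightarrow> (real \<Rightarrow> complex) \<Rightarrow> bool" where
  "is_delta_series T w \<longleftrightarrow>
     (\<forall>R. finite {x \<in> {-R..R}. w x \<noteq> 0}) \<and>
     (\<forall>\<phi>. schwartz \<phi> \<longrightarrow> ((\<lambda>x. w x * \<phi> x) has_sum T \<phi>) UNIV)"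

definition delta_weight :: "distribution \<Rightarrow> real \<Rightarrow> complex" where
  "delta_weight T = (THE w. is_delta_series T w)"

definition delta_mass :: "distribution \<Rightarrow> real set \<Rightarrow> complex" where
  "delta_mass T A = (\<Sum>\<^sub>\<infinity>x\<in>A. delta_weight T x)"

definition frft_comb_pos :: "real \<Rightarrow> real \<Rightarrow> complex" where
  "frft_comb_pos \<alpha> X =
     (delta_mass (frft_distr \<alpha> dirac_comb) {0..X} +
      delta_mass (frft_distr \<alpha> dirac_comb) {0<..<X}) / 2"

definition frft_comb_antideriv :: "real \<Rightarrow> real \<Rightarrow> complex" where
  "frft_comb_antideriv \<alpha> X =
     (if X > 0 then frft_comb_pos \<alpha> X
      else if X < 0 then - frft_comb_pos \<alpha> (- X)
      else 0)"

definition fresnel :: "real \<Rightarrow> complex" where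
  "fresnel X = (LBINT x=ereal 0..ereal X. exp (of_real pi * \<i> * of_real (x\<^sup>2)))"

end

theory Submission
  imports Defs "HOL-Real_Asymp.Real_Asymp"
begin

text \<open>
  Write \<open>q\<close> for the cotangent and \<open>s\<close> for the sine of \<open>\<pi>\<alpha>/2\<close>.  In the theorem
  \<open>q = p/b\<close> with \<open>p = a + jb\<close>, and \<open>s = 1 / sqrt (1 + q\<^sup>2)\<close> is about \<open>1/j\<close>.

  For a Schwartz function \<open>\<phi>\<close> the value of its fractional Fourier transform at an integer \<open>k\<close> is, up to
  the factor \<open>1 / sqrt (\<i>s)\<close>, the chirp \<open>e(q k\<^sup>2/2)\<close> times the Fourier transform of \<open>e(q y\<^sup>2/2) \<phi>(y)\<close>
  at \<open>k/s\<close>, where \<open>e(t)\<close> is \<open>exp (2\<pi>\<i>t)\<close>.  Since \<open>q\<close> has denominator \<open>b\<close>, the outer chirp depends only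
  on \<open>k\<close> modulo \<open>2b\<close>, and Poisson summation in each residue class turns the sum over \<open>k\<close> into a sum
  over the lattice \<open>h\<int>\<close> with \<open>h = s/(2b)\<close>.  So the transformed comb has at \<open>hn\<close> the mass
  \<open>h / sqrt (\<i>s) * G(n) * e(q (hn)\<^sup>2/2)\<close>, where \<open>G\<close> is a \<open>2b\<close>-periodic quadratic Gauss sum
  (\<open>frft_comb_has_sum\<close>).  A function of point masses is determined by its distribution, as narrow
  Gaussians show (\<open>is_delta_series_unique\<close>), so this is the measure that the antiderivative refers to.

  The two properties of \<open>G\<close> that enter are \<open>\<bar>G\<bar> \<le> 2b\<close> and that its mean over a period is \<open>1\<close>.
  Along a residue class \<open>n = 2bm + r\<close> the remaining factor is \<open>exp (\<i>\<kappa>(m + \<rho>)\<^sup>2)\<close> with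
  \<open>\<kappa> = \<pi>qs\<^sup>2\<close> and \<open>\<rho> = r/(2b)\<close>.  For \<open>hn \<le> X\<close> the phase advances from one \<open>m\<close> to the next by at most
  about \<open>2\<pi>X\<close>, which is small since \<open>X\<close> tends to \<open>0\<close>; by van der Corput's comparison the sum over \<open>m\<close>
  then differs from the corresponding integral by at most an absolute constant, however many terms
  there are (\<open>quadratic_exponential_sum\<close>).  This is why \<open>X\<close> may decrease like an arbitrarily small
  power of \<open>j\<close>.  Summing over the residue classes gives
  \<open>e(-1/8) S(sqrt q X) / sqrt (sq)\<close> with an error \<open>O(sqrt s)\<close>
  (\<open>frft_comb_antideriv_estimate\<close>).  Finally \<open>1 / sqrt s - sqrt q\<close> and \<open>sqrt q - sqrt j\<close> tend to \<open>0\<close>,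
  and \<open>S\<close> has Lipschitz constant \<open>1\<close>, so this main term may be replaced by \<open>e(-1/8) S(sqrt j X)\<close>.

  Poisson summation is obtained for \<open>C\<^sup>2\<close> functions that decay quadratically together with their first
  two derivatives, by two integrations by parts:
  both sides of the formula become integrals of the second derivative against the periodic Bernoulli
  polynomial of degree two, once as its Fourier series and once in the Euler-Maclaurin formula.
\<close>

section \<open>The Fourier series of the second Bernoulli polynomial\<close>

lemma dirichlet_kernel: "sin y * (1 + 2 * (\<Sum>k<n. cos (2 * (real k + 1) * y))) = sin ((2 * real n + 1) * y)"
proof (induction n)
  case (Suc n)
  have "sin y * (2 * cos (2 * (real n + 1) * y)) = sin ((2 * real (Suc n) + 1) * y) - sin ((2 * real n + 1) * y)"
    using sin_add[of "2 * (real n + 1) * y" y] sin_diff[of "2 * (real n + 1) * y" y]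
    by (simp add: algebra_simps)
  then show ?case using Suc by (simp add: algebra_simps)
qed simp

text \<open>
  The cosine sum with triangular weights is a sum of Dirichlet kernels, and multiplied by the square of
  the sine these telescope to a square.  Away from the zeros of the sine the cosine sum is therefore
  bounded independently of \<open>n\<close>.
\<close>
lemma fejer_kernel:
  "(sin y)\<^sup>2 * (real n + 1 + 2 * (\<Sum>k<n. (real n - real k) * cos (2 * (real k + 1) * y))) = (sin ((real n + 1) * y))\<^sup>2"
proof (induction n)
  case (Suc n)
  have "(\<Sum>k<Suc n. (real (Suc n) - real k) * cos (2 * (real k + 1) * y)) = 
    (\<Sum>k<n. (real n - real k) * cos (2 * (real k + 1) * y)) + (\<Sum>k<Suc n. cos (2 * (real k + 1) * y))"
    by (simp add: sum.distrib[symmetric] algebra_simps)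
  then have "(sin y)\<^sup>2 * (real (Suc n) + 1 + 2 * (\<Sum>k<Suc n. (real (Suc n) - real k) * cos (2 * (real k + 1) * y)))
     = (sin y)\<^sup>2 * (real n + 1 + 2 * (\<Sum>k<n. (real n - real k) * cos (2 * (real k + 1) * y)))
      + sin y * (sin y * (1 + 2 * (\<Sum>k<Suc n. cos (2 * (real k + 1) * y))))"
    by (simp only: of_nat_Suc power2_eq_square) (simp add: algebra_simps)
  also have "\<dots> = (sin ((real n + 1) * y))\<^sup>2 + sin y * sin ((2 * real (Suc n) + 1) * y)"
    by (simp only: Suc dirichlet_kernel)
  also have "\<dots> = (sin ((real (Suc n) + 1) * y))\<^sup>2"
  proof -
    have *: "(sin (u + v))\<^sup>2 - (sin u)\<^sup>2 = sin v * sin (2 * u + v)" for u v :: real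
    proof -
      have "sin (2 * u + v) = sin u * cos (u + v) + cos u * sin (u + v)"
        using sin_add[of u "u + v"] by (simp add: algebra_simps)
      moreover have "sin v = sin (u + v) * cos u - cos (u + v) * sin u"
        using sin_diff[of "u + v" u] by simp
      ultimately have "sin v * sin (2 * u + v) = (sin (u + v))\<^sup>2 * (cos u)\<^sup>2 - (cos (u + v))\<^sup>2 * (sin u)\<^sup>2"
        by (simp only: power2_eq_square) (simp add: algebra_simps)
      then show ?thesis by (simp add: cos_squared_eq algebra_simps)
    qed
    show ?thesis using *[of "(real n + 1) * y" y] by (simp add: algebra_simps)
  qed
  finally show ?case .
qed simp

lemma summable_inverse_squares_Suc: "summable (\<lambda>k. 1 / (real k + 1)\<^sup>2)"
  using inverse_squares_sums by (simp add: sums_iff add.commute)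

definition cos_series :: "real \<Rightarrow> real" where
  "cos_series x = (\<Sum>k. cos (2 * pi * (real k + 1) * x) / (real k + 1)\<^sup>2)"

lemma cos_series_uniform:
  "uniform_limit UNIV (\<lambda>n x. \<Sum>k<n. cos (2 * pi * (real k + 1) * x) / (real k + 1)\<^sup>2) cos_series sequentially"
  unfolding cos_series_def
  by (rule Weierstrass_m_test[OF _ summable_inverse_squares_Suc]) (auto simp: divide_simps abs_mult)

lemma continuous_on_cos_series: "continuous_on A cos_series"
proof -
  have "continuous_on UNIV cos_series"
    by (rule uniform_limit_theorem[OF _ cos_series_uniform])
       (simp_all add: continuous_on_sum continuous_intros)
  then show ?thesis using continuous_on_subset by blast
qed

text \<open>
  The convergence is absolute, so the triangular weights, which tend to \<open>1\<close>, may be introduced by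
  dominated convergence.
\<close>
lemma cos_series_fejer_means:
  "(\<lambda>n. \<Sum>k<n. (1 - (real k + 1) / (real n + 1)) * (cos (2 * pi * (real k + 1) * x) / (real k + 1)\<^sup>2)) \<longlonglongrightarrow> cos_series x"
proof -
  define f where "f = (\<lambda>k n. if k < n then (1 - (real k + 1) / (real n + 1)) * (cos (2 * pi * (real k + 1) * x) / (real k + 1)\<^sup>2) else 0)"
  have b: "norm (f k n) \<le> 1 / (real k + 1)\<^sup>2" for k n
  proof (cases "k < n")
    case True
    have "\<bar>1 - (real k + 1) / (real n + 1)\<bar> * \<bar>cos (2 * pi * (real k + 1) * x)\<bar> \<le> 1 * 1"
      using True by (intro mult_mono) (auto simp: divide_simps)
    then show ?thesis using True by (simp add: f_def abs_mult divide_simps)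
  qed (simp add: f_def)
  have "(\<lambda>n. \<Sum>k. f k n) \<longlonglongrightarrow> (\<Sum>k. cos (2 * pi * (real k + 1) * x) / (real k + 1)\<^sup>2)"
  proof (rule tannerys_theorem[OF _ _ summable_inverse_squares_Suc, THEN conjunct2, THEN conjunct2])
    fix k
    have "(\<lambda>n. (1 - (real k + 1) / (real n + 1)) * (cos (2 * pi * (real k + 1) * x) / (real k + 1)\<^sup>2))
       \<longlonglongrightarrow> (1 - 0) * (cos (2 * pi * (real k + 1) * x) / (real k + 1)\<^sup>2)"
      by (intro tendsto_intros tendsto_divide_0[OF tendsto_const] filterlim_at_top_imp_at_infinity
           filterlim_tendsto_add_at_top[OF tendsto_const] filterlim_real_sequentially
          | subst add.commute)+
    then have "(\<lambda>n. (1 - (real k + 1) / (real n + 1)) * (cos (2 * pi * (real k + 1) * x) / (real k + 1)\<^sup>2))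
       \<longlonglongrightarrow> cos (2 * pi * (real k + 1) * x) / (real k + 1)\<^sup>2" by simp
    then show "(\<lambda>n. f k n) \<longlonglongrightarrow> cos (2 * pi * (real k + 1) * x) / (real k + 1)\<^sup>2"
      by (rule Lim_transform_eventually)
         (auto simp: f_def eventually_sequentially intro!: exI[of _ "Suc k"])
    show "\<forall>\<^sub>F (k, n) in at_top \<times>\<^sub>F sequentially. norm (f k n) \<le> 1 / (real k + 1)\<^sup>2"
      by (rule always_eventually) (use b in \<open>simp add: split_def\<close>)
  qed simp
  moreover have "(\<Sum>k. f k n) = (\<Sum>k<n. (1 - (real k + 1) / (real n + 1)) * (cos (2 * pi * (real k + 1) * x) / (real k + 1)\<^sup>2))" for n
    by (subst suminf_finite[of "{..<n}"]) (auto simp: f_def)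
  ultimately show ?thesis by (simp add: cos_series_def)
qed

text \<open>
  The second derivative of the \<open>n\<close>-th Fejer mean of the left-hand side is the square of
  \<open>sin ((n + 1)\<pi>t) / sin (\<pi>t)\<close> divided by \<open>n + 1\<close>, which tends to \<open>0\<close> uniformly on compact subsets
  of the open unit interval.  The first derivative vanishes at \<open>1/2\<close> by symmetry, so integrating twice from \<open>1/2\<close> shows that the means become
  constant.
\<close>
lemma cos_series_const:
  assumes x: "0 < x" "x < 1"
  shows "(x\<^sup>2 - x) / 2 - cos_series x / (2 * pi\<^sup>2) = ((1/2)\<^sup>2 - 1/2) / 2 - cos_series (1/2) / (2 * pi\<^sup>2)"
proof -
  define c where "c = (\<lambda>n k::nat. 1 - (real k + 1) / (real n + 1))"
  define w where "w = (\<lambda>k::nat. 2 * pi * (real k + 1))"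
  define a where "a = (\<lambda>n k. c n k / ((real k + 1)\<^sup>2 * (2 * pi\<^sup>2)))"
  \<comment> \<open>the Fejer mean and its first two derivatives\<close>
  define g where "g = (\<lambda>n t. (t\<^sup>2 - t) / 2 - (\<Sum>k<n. a n k * cos (w k * t)))"
  define g1 where "g1 = (\<lambda>n t. t - 1/2 + (\<Sum>k<n. a n k * w k * sin (w k * t)))"
  define g2 where "g2 = (\<lambda>n t. 1 + (\<Sum>k<n. a n k * (w k)\<^sup>2 * cos (w k * t)))"
  have a: "a n k * (w k)\<^sup>2 = 2 * c n k" for n k
    by (simp add: a_def w_def power_mult_distrib)
  define d where "d = min x (1 - x)"
  have d: "0 < d" "d \<le> 1/2" using x by (auto simp: d_def min_def)
  have S: "sin (pi * d) > 0" using d by (intro sin_gt_zero) auto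
  have g': "(g n has_real_derivative g1 n t) (at t within A)" for n t A
  proof -
    have "((\<lambda>t. \<Sum>k<n. a n k * cos (w k * t)) has_real_derivative (\<Sum>k<n. - (a n k * w k * sin (w k * t)))) (at t within A)"
      by (intro DERIV_sum) (auto intro!: derivative_eq_intros)
    then have "((\<lambda>t. (t\<^sup>2 - t) / 2 - (\<Sum>k<n. a n k * cos (w k * t))) has_real_derivative
       (2 * t - 1) / 2 - (\<Sum>k<n. - (a n k * w k * sin (w k * t)))) (at t within A)"
      by (intro DERIV_diff) (auto intro!: derivative_eq_intros)
    then show ?thesis unfolding g_def g1_def
      by (simp add: sum_negf diff_divide_distrib)
  qed
  have g1': "(g1 n has_real_derivative g2 n t) (at t within A)" for n t A
  proof -
    have "((\<lambda>t. \<Sum>k<n. a n k * w k * sin (w k * t)) has_real_derivative (\<Sum>k<n. a n k * (w k)\<^sup>2 * cos (w k * t))) (at t within A)"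
      by (intro DERIV_sum) (auto intro!: derivative_eq_intros simp: power2_eq_square)
    moreover have "((\<lambda>t. t - 1/2) has_real_derivative 1) (at t within A)"
      by (auto intro!: derivative_eq_intros)
    ultimately show ?thesis unfolding g1_def g2_def by (rule DERIV_add[rotated])
  qed
  \<comment> \<open>the minimum of the sine on the interval is attained at the end points\<close>
  have sin_mono: "sin (pi * d) \<le> sin (pi * t)" if "t \<in> {d..1-d}" for t
  proof (cases "t \<le> 1/2")
    case True
    have "- (pi / 2) \<le> pi * d" by (rule order_trans[of "- (pi/2)" 0]) (use d in auto)
    then show ?thesis using that d True by (intro sin_monotone_2pi_le) auto
  next
    case False
    have "- (pi / 2) \<le> pi * d" by (rule order_trans[of "- (pi/2)" 0]) (use d in auto)
    then have "sin (pi * d) \<le> sin (pi * (1 - t))" using that d False by (intro sin_monotone_2pi_le) auto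
    also have "\<dots> = sin (pi * t)" by (simp add: algebra_simps)
    finally show ?thesis .
  qed
  have g2_bound: "\<bar>g2 n t\<bar> \<le> 1 / ((real n + 1) * (sin (pi * d))\<^sup>2)" if t: "t \<in> {d..1-d}" for n t
  proof -
    have c: "(real n + 1) * c n k = real n - real k" for k
      by (simp add: c_def field_simps)
    have "(real n + 1) * g2 n t = real n + 1 + 2 * (\<Sum>k<n. ((real n + 1) * c n k) * cos (w k * t))"
      unfolding g2_def a by (simp only: distrib_left[of "real n + 1"] sum_distrib_left mult_ac mult_1_left)
    then have "(real n + 1) * g2 n t = real n + 1 + 2 * (\<Sum>k<n. (real n - real k) * cos (2 * (real k + 1) * (pi * t)))"
      by (simp only: c) (simp add: w_def mult_ac)
    then have "(sin (pi * t))\<^sup>2 * ((real n + 1) * g2 n t) = (sin ((real n + 1) * (pi * t)))\<^sup>2"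
      by (simp only: fejer_kernel)
    then have "\<bar>(sin (pi * t))\<^sup>2 * ((real n + 1) * g2 n t)\<bar> \<le> 1"
      by (simp add: abs_square_le_1)
    then have *: "(sin (pi * t))\<^sup>2 * ((real n + 1) * \<bar>g2 n t\<bar>) \<le> 1"
      by (simp add: abs_mult)
    have "(sin (pi * d))\<^sup>2 * ((real n + 1) * \<bar>g2 n t\<bar>) \<le> (sin (pi * t))\<^sup>2 * ((real n + 1) * \<bar>g2 n t\<bar>)"
      using sin_mono[OF t] S by (intro mult_right_mono power_mono) auto
    with * have "(sin (pi * d))\<^sup>2 * ((real n + 1) * \<bar>g2 n t\<bar>) \<le> 1" by linarith
    moreover have "(real n + 1) * (sin (pi * d))\<^sup>2 > 0" using S by (intro mult_pos_pos) auto
    ultimately show ?thesis by (subst pos_le_divide_eq) (auto simp: mult_ac)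
  qed
  have g1_half: "g1 n (1/2) = 0" for n
  proof -
    have "sin (w k * (1/2)) = 0" for k
      using sin_npi[of "Suc k"] by (simp add: w_def algebra_simps)
    then show ?thesis unfolding g1_def by simp
  qed
  have half: "1/2 \<in> {d..1-d}" using d by auto
  have g1_bound: "\<bar>g1 n t\<bar> \<le> 1 / ((real n + 1) * (sin (pi * d))\<^sup>2)" if t: "t \<in> {d..1-d}" for n t
  proof -
    have "norm (g1 n t - g1 n (1/2)) \<le> 1 / ((real n + 1) * (sin (pi * d))\<^sup>2) * norm (t - 1/2)"
      by (rule field_differentiable_bound[of "{d..1-d}", OF _ g1'])
         (use t half g2_bound in auto)
    also have "\<dots> \<le> 1 / ((real n + 1) * (sin (pi * d))\<^sup>2) * 1"
      using t d S by (intro mult_left_mono) auto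
    finally show ?thesis by (simp add: g1_half)
  qed
  have g_bound: "\<bar>g n x - g n (1/2)\<bar> \<le> 1 / (sin (pi * d))\<^sup>2 * inverse (real (Suc n))" for n
  proof -
    have "norm (g n x - g n (1/2)) \<le> 1 / ((real n + 1) * (sin (pi * d))\<^sup>2) * norm (x - 1/2)"
      by (rule field_differentiable_bound[of "{d..1-d}", OF _ g'])
         (use x half g1_bound in \<open>auto simp: d_def\<close>)
    also have "\<dots> \<le> 1 / ((real n + 1) * (sin (pi * d))\<^sup>2) * 1"
      using x d S by (intro mult_left_mono) (auto simp: abs_if)
    also have "\<dots> = 1 / (sin (pi * d))\<^sup>2 * inverse (real (Suc n))"
      by (simp only: divide_inverse inverse_mult_distrib mult_1_left mult_1_right of_nat_Suc
           mult.commute[of "inverse (real n + 1)"] add.commute[of 1])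
    finally show ?thesis by simp
  qed
  have lim: "(\<lambda>n. g n t) \<longlonglongrightarrow> (t\<^sup>2 - t) / 2 - cos_series t / (2 * pi\<^sup>2)" for t
  proof -
    have "(\<Sum>k<n. a n k * cos (w k * t)) =
       (\<Sum>k<n. (1 - (real k + 1) / (real n + 1)) * (cos (2 * pi * (real k + 1) * t) / (real k + 1)\<^sup>2)) / (2 * pi\<^sup>2)" for n
      by (simp add: a_def c_def w_def sum_divide_distrib)
    then show ?thesis
      unfolding g_def by (simp only:) (intro tendsto_intros cos_series_fejer_means, simp)
  qed
  have "(\<lambda>n. g n x - g n (1/2)) \<longlonglongrightarrow> 0"
  proof (rule Lim_null_comparison)
    show "\<forall>\<^sub>F n in sequentially. norm (g n x - g n (1/2)) \<le> 1 / (sin (pi * d))\<^sup>2 * inverse (real (Suc n))"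
      using g_bound by (intro always_eventually) auto
  qed (intro tendsto_mult_right_zero LIMSEQ_inverse_real_of_nat)
  from LIMSEQ_unique[OF this tendsto_diff[OF lim[of x] lim[of "1/2"]]] show ?thesis by simp
qed

text \<open>
  By continuity the difference is constant on the closed interval, and its value at \<open>0\<close> is Euler's sum
  of the inverse squares.
\<close>
lemma cos_series_eq:
  assumes "x \<in> {0..1}"
  shows "cos_series x = pi\<^sup>2 * (x\<^sup>2 - x + 1/6)"
proof -
  define D where "D = (\<lambda>x. (x\<^sup>2 - x) / 2 - cos_series x / (2 * pi\<^sup>2))"
  have D: "continuous_on A D" for A
    unfolding D_def by (intro continuous_intros continuous_on_cos_series) auto
  have cl: "closure {0<..<1::real} = {0..1}" by (simp add: closure_greaterThanLessThan)
  have "D t = D (1/2)" if "t \<in> closure {0<..<1}" for t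
    by (rule continuous_constant_on_closure[OF D _ that]) (unfold D_def, rule cos_series_const, auto)
  from this[of x] this[of 0] have "D x = D 0" using assms unfolding cl by simp
  moreover have "cos_series 0 = pi\<^sup>2 / 6"
    using inverse_squares_sums by (simp add: cos_series_def sums_iff add.commute)
  ultimately show ?thesis by (simp add: D_def field_simps)
qed

section \<open>Poisson summation\<close>

lemma integrable_inverse_1_plus_square: "integrable lborel (\<lambda>x::real. 1 / (1 + x\<^sup>2))"
proof -
  have "set_integrable lborel (einterval (-\<infinity>) \<infinity>) (\<lambda>x::real. 1 / (1 + x\<^sup>2))"
  proof (rule interval_integral_FTC_nonneg(1))
    show "((arctan \<circ> real_of_ereal) \<longlongrightarrow> pi / 2) (at_left \<infinity>)"
      by (simp add: at_left_PInf filterlim_filtermap o_def tendsto_arctan_at_top)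
    show "((arctan \<circ> real_of_ereal) \<longlongrightarrow> - (pi / 2)) (at_right (- \<infinity>))"
      by (simp add: at_right_MInf filterlim_filtermap o_def tendsto_arctan_at_bot)
    show "(arctan has_real_derivative 1 / (1 + x\<^sup>2)) (at x)" for x
      using DERIV_arctan[of x] by (simp add: divide_inverse)
    show "isCont (\<lambda>x::real. 1 / (1 + x\<^sup>2)) x" for x
      by (auto intro!: continuous_intros simp: add_nonneg_eq_0_iff)
  qed (auto simp: add_nonneg_nonneg)
  then show ?thesis by (simp add: set_integrable_def)
qed

lemma integrable_of_inverse_square_decay:
  fixes f :: "real \<Rightarrow> complex"
  assumes "continuous_on UNIV f" and "\<And>x. norm (f x) \<le> C / (1 + x\<^sup>2)"
  shows "integrable lborel f"
proof (rule Bochner_Integration.integrable_bound)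
  show "integrable lborel (\<lambda>x. C * (1 / (1 + x\<^sup>2)))"
    by (intro integrable_mult_right integrable_inverse_1_plus_square)
  show "f \<in> borel_measurable lborel"
    using borel_measurable_continuous_onI[OF assms(1)] by simp
  show "AE x in lborel. norm (f x) \<le> norm (C * (1 / (1 + x\<^sup>2)))"
    by (intro AE_I2 order_trans[OF assms(2)]) (simp add: divide_right_mono)
qed

lemma tendsto_0_of_inverse_square_decay:
  fixes f :: "real \<Rightarrow> complex"
  assumes "\<And>x. norm (f x) \<le> C / (1 + x\<^sup>2)"
  shows "(f \<longlongrightarrow> 0) at_infinity"
proof (rule Lim_null_comparison)
  show "\<forall>\<^sub>F x in at_infinity. norm (f x) \<le> C / (1 + x\<^sup>2)"
    using assms by (intro always_eventually) auto
  have "filterlim (\<lambda>x::real. 1 + x\<^sup>2) at_top at_infinity"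
    using filterlim_tendsto_add_at_top[OF tendsto_const[of 1]
        filterlim_pow_at_top[OF _ filterlim_norm_at_top[where ?'a = real]], of 2] by simp
  then show "((\<lambda>x::real. C / (1 + x\<^sup>2)) \<longlongrightarrow> 0) at_infinity"
    by (intro tendsto_divide_0[OF tendsto_const] filterlim_at_top_imp_at_infinity)
qed

lemma integral_derivative_eq_0:
  fixes F :: "real \<Rightarrow> complex"
  assumes "\<And>x. (F has_vector_derivative g x) (at x)" "continuous_on UNIV g" "integrable lborel g"
    and "(F \<longlongrightarrow> 0) at_infinity"
  shows "(LINT x|lborel. g x) = 0"
proof -
  have "(LBINT x=-\<infinity>..\<infinity>. g x) = 0 - 0"
  proof (rule interval_integral_FTC_integrable)
    show "((F \<circ> real_of_ereal) \<longlongrightarrow> 0) (at_left \<infinity>)"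
      using tendsto_mono[OF at_top_le_at_infinity assms(4)] by (simp add: at_left_PInf filterlim_filtermap o_def)
    show "((F \<circ> real_of_ereal) \<longlongrightarrow> 0) (at_right (- \<infinity>))"
      using tendsto_mono[OF at_bot_le_at_infinity assms(4)] by (simp add: at_right_MInf filterlim_filtermap o_def)
    show "isCont g x" for x using assms(2) by (simp add: continuous_on_eq_continuous_at)
    show "set_integrable lborel (einterval (-\<infinity>) \<infinity>) g" using assms(3) by (simp add: set_integrable_def)
  qed (use assms(1) in auto)
  then show ?thesis by (simp add: interval_lebesgue_integral_def set_lebesgue_integral_def)
qed

lemma summable_on_int:
  fixes f :: "int \<Rightarrow> complex"
  assumes "\<And>n. n \<noteq> 0 \<Longrightarrow> norm (f n) \<le> C / (of_int n)\<^sup>2"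
  shows "f summable_on UNIV"
proof -
  have *: "f summable_on range g" if g: "inj g" "\<And>n. \<bar>g n\<bar> = int n" for g :: "nat \<Rightarrow> int"
  proof -
    have "summable (\<lambda>n. norm (f (g n)))"
    proof (rule summable_comparison_test_ev)
      show "\<forall>\<^sub>F n in sequentially. norm (norm (f (g n))) \<le> C * (1 / (real n)\<^sup>2)"
        unfolding eventually_sequentially
      proof (intro exI[of _ 1] allI impI)
        fix n :: nat assume "1 \<le> n"
        then have "g n \<noteq> 0" using g(2)[of n] by auto
        moreover have "\<bar>of_int (g n) :: real\<bar> = real n" using g(2)[of n] by linarith
        then have "(of_int (g n) :: real)\<^sup>2 = (real n)\<^sup>2" by (metis power2_abs)
        ultimately show "norm (norm (f (g n))) \<le> C * (1 / (real n)\<^sup>2)" using assms[of "g n"] by simp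
      qed
      show "summable (\<lambda>n. C * (1 / (real n)\<^sup>2))"
        using inverse_power_summable[of 2, where ?'a=real] by (intro summable_mult) (simp add: divide_inverse)
    qed
    then have "(\<lambda>n. f (g n)) summable_on UNIV" by (rule norm_summable_imp_summable_on)
    then show ?thesis using summable_on_reindex[OF g(1), of f] by (simp add: o_def)
  qed
  have "f summable_on range int \<union> range (\<lambda>n. - int n)"
    by (intro summable_on_union *) (auto simp: inj_on_def)
  moreover have "range int \<union> range (\<lambda>n. - int n) = UNIV"
    by (auto, metis int_cases2 rangeI)
  ultimately show ?thesis by simp
qed

lemma summable_on_int_of_decay:
  fixes f :: "real \<Rightarrow> complex"
  assumes "\<And>x. norm (f x) \<le> C / (1 + x\<^sup>2)"
  shows "(\<lambda>n::int. f (of_int n)) summable_on UNIV"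
proof (rule summable_on_int)
  fix n :: int assume "n \<noteq> 0"
  have "0 \<le> C" using order_trans[OF norm_ge_zero assms[of 0]] by simp
  then have "C / (1 + (real_of_int n)\<^sup>2) \<le> C / (real_of_int n)\<^sup>2"
    using \<open>n \<noteq> 0\<close> by (intro divide_left_mono) (auto simp: add_pos_pos)
  then show "norm (f (of_int n)) \<le> C / (real_of_int n)\<^sup>2" using assms[of "of_int n"] by linarith
qed

lemma has_sum_int_symmetric_limit:
  fixes f :: "int \<Rightarrow> 'a::topological_comm_monoid_add"
  assumes "(f has_sum S) UNIV"
  shows "(\<lambda>m::nat. \<Sum>n\<in>{- int m..int m}. f n) \<longlonglongrightarrow> S"
proof -
  have "filterlim (\<lambda>m::nat. {- int m..int m}) (finite_subsets_at_top UNIV) sequentially"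
    unfolding filterlim_finite_subsets_at_top
  proof (intro allI impI)
    fix X :: "int set" assume "finite X \<and> X \<subseteq> UNIV"
    then have "finite ((\<lambda>x. nat \<bar>x\<bar>) ` X)" by simp
    then obtain M where M: "\<forall>y\<in>(\<lambda>x. nat \<bar>x\<bar>) ` X. y \<le> M" using finite_nat_set_iff_bounded_le by blast
    have "X \<subseteq> {- int m..int m}" if "m \<ge> M" for m
    proof
      fix x assume "x \<in> X"
      then have "nat \<bar>x\<bar> \<le> m" using M that by fastforce
      then show "x \<in> {- int m..int m}" by auto
    qed
    then show "\<forall>\<^sub>F m in sequentially. finite {- int m..int m} \<and> X \<subseteq> {- int m..int m} \<and> {- int m..int m} \<subseteq> UNIV"
      by (auto simp: eventually_sequentially)
  qed
  from filterlim_compose[OF assms[unfolded has_sum_def] this] show ?thesis .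
qed

lemma sum_int_symmetric_Suc:
  fixes f :: "int \<Rightarrow> 'a::ab_group_add"
  shows "(\<Sum>n\<in>{- int (Suc m)..int (Suc m)}. f n) = (\<Sum>n\<in>{- int m..int m}. f n) + f (int m + 1) + f (- int m - 1)"
proof -
  have "{- int (Suc m)..int (Suc m)} = insert (int m + 1) (insert (- int m - 1) {- int m..int m})" by auto
  then show ?thesis by (simp add: add_ac)
qed

lemma cos_series_int_shift:
  assumes "x \<in> {of_int n..of_int n + 1}"
  shows "cos_series x = pi\<^sup>2 * ((x - of_int n)\<^sup>2 - (x - of_int n) + 1/6)"
proof -
  have "cos (2 * pi * (real k + 1) * x) = cos (2 * pi * (real k + 1) * (x - of_int n))" for k
    using cos.plus_of_int[of "2 * pi * (real k + 1) * (x - of_int n)" "(int k + 1) * n"]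
    by (simp add: algebra_simps)
  then have "cos_series x = cos_series (x - of_int n)" by (simp add: cos_series_def)
  then show ?thesis using cos_series_eq[of "x - of_int n"] assms by simp
qed

lemma cos_series_partial_bound: "\<bar>\<Sum>k<n. cos (2 * pi * (real k + 1) * x) / (real k + 1)\<^sup>2\<bar> \<le> pi\<^sup>2 / 6"
proof -
  have "\<bar>\<Sum>k<n. cos (2 * pi * (real k + 1) * x) / (real k + 1)\<^sup>2\<bar> \<le> (\<Sum>k<n. 1 / (real k + 1)\<^sup>2)"
    by (rule order_trans[OF sum_abs sum_mono]) (simp add: abs_mult divide_right_mono)
  also have "\<dots> \<le> (\<Sum>k. 1 / (real k + 1)\<^sup>2)"
    by (rule sum_le_suminf[OF summable_inverse_squares_Suc]) auto
  also have "\<dots> = pi\<^sup>2 / 6" using inverse_squares_sums by (simp add: sums_iff add.commute)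
  finally show ?thesis .
qed

lemma cos_series_bound: "\<bar>cos_series x\<bar> \<le> pi\<^sup>2 / 6"
proof (rule tendsto_upperbound)
  show "(\<lambda>n. \<bar>\<Sum>k<n. cos (2 * pi * (real k + 1) * x) / (real k + 1)\<^sup>2\<bar>) \<longlonglongrightarrow> \<bar>cos_series x\<bar>"
    by (intro tendsto_rabs tendsto_uniform_limitI[OF cos_series_uniform]) auto
qed (use cos_series_partial_bound in \<open>auto intro!: always_eventually\<close>)

lemma has_vector_derivative_cis:
  assumes "(g has_real_derivative g') (at x)"
  shows "((\<lambda>x. cis (g x)) has_vector_derivative of_real g' * (\<i> * cis (g x))) (at x)"
proof -
  have "(cis has_vector_derivative \<i> * cis (g x)) (at (g x))"
    using has_derivative_cis[OF has_derivative_ident, of "g x" UNIV]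
    by (simp add: has_vector_derivative_def)
  from vector_diff_chain_at[OF assms[unfolded has_real_derivative_iff_has_vector_derivative] this]
  show ?thesis by (simp add: o_def scaleR_conv_of_real)
qed

text \<open>
  The function \<open>f' e - \<i>\<omega> f e\<close> with \<open>e = cis (\<omega>x)\<close> vanishes at infinity and has the derivative
  \<open>f'' e + \<omega>\<^sup>2 f e\<close>, so that the two integrations by parts are a single one.
\<close>
lemma integral_cis_by_parts:
  fixes f f1 f2 :: "real \<Rightarrow> complex"
  assumes f: "\<And>x. (f has_vector_derivative f1 x) (at x)" "\<And>x. (f1 has_vector_derivative f2 x) (at x)"
    and f2: "continuous_on UNIV f2"
    and decay: "\<And>x. norm (f x) \<le> C / (1 + x\<^sup>2)" "\<And>x. norm (f1 x) \<le> C / (1 + x\<^sup>2)" "\<And>x. norm (f2 x) \<le> C / (1 + x\<^sup>2)"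
  shows "(LINT x|lborel. f2 x * cis (\<omega> * x)) = - of_real (\<omega>\<^sup>2) * (LINT x|lborel. f x * cis (\<omega> * x))"
proof -
  define c where "c = \<i> * complex_of_real \<omega>"
  define e where "e = (\<lambda>x. cis (\<omega> * x))"
  have e: "(e has_vector_derivative c * e x) (at x)" for x
    using has_vector_derivative_cis[OF DERIV_cmult_Id, of \<omega> x] by (simp add: e_def c_def mult_ac)
  have ne: "norm (e x) = 1" for x by (simp add: e_def)
  have cf: "continuous_on UNIV f" "continuous_on UNIV f1"
    using has_vector_derivative_continuous[OF f(1)] has_vector_derivative_continuous[OF f(2)]
    by (simp_all add: continuous_on_eq_continuous_at)
  have ce: "continuous_on UNIV e"
    unfolding e_def by (intro continuous_intros)
  have int: "integrable lborel (\<lambda>x. f x * e x)" "integrable lborel (\<lambda>x. f2 x * e x)"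
    by (rule integrable_of_inverse_square_decay[where C = C];
        use cf ce f2 decay in \<open>auto intro!: continuous_on_mult simp: norm_mult ne\<close>)+
  have "(LINT x|lborel. f2 x * e x - c\<^sup>2 * (f x * e x)) = 0"
  proof (rule integral_derivative_eq_0)
    fix x
    have "((\<lambda>x. f1 x * e x - c * (f x * e x)) has_vector_derivative
        (f1 x * (c * e x) + f2 x * e x) - c * (f x * (c * e x) + f1 x * e x)) (at x)"
      by (intro has_vector_derivative_diff has_vector_derivative_mult has_vector_derivative_mult_right f e)
    then show "((\<lambda>x. f1 x * e x - c * (f x * e x)) has_vector_derivative f2 x * e x - c\<^sup>2 * (f x * e x)) (at x)"
      by (simp add: algebra_simps power2_eq_square)
  next
    show "continuous_on UNIV (\<lambda>x. f2 x * e x - c\<^sup>2 * (f x * e x))"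
      by (intro continuous_on_diff continuous_on_mult continuous_on_const f2 ce cf)
    show "integrable lborel (\<lambda>x. f2 x * e x - c\<^sup>2 * (f x * e x))"
      by (intro Bochner_Integration.integrable_diff integrable_mult_right int)
    have "((\<lambda>x. f1 x * e x) \<longlongrightarrow> 0) at_infinity" "((\<lambda>x. f x * e x) \<longlongrightarrow> 0) at_infinity"
      by (rule tendsto_0_of_inverse_square_decay[where C = C]; simp add: norm_mult ne decay)+
    then show "((\<lambda>x. f1 x * e x - c * (f x * e x)) \<longlongrightarrow> 0) at_infinity"
      using tendsto_diff[OF _ tendsto_mult[OF tendsto_const], of "\<lambda>x. f1 x * e x" 0 at_infinity "\<lambda>x. f x * e x" 0 c] by simp
  qed
  then have "(LINT x|lborel. f2 x * e x) = c\<^sup>2 * (LINT x|lborel. f x * e x)"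
    using int by simp
  then show ?thesis by (simp add: e_def c_def power_mult_distrib)
qed

text \<open>
  One step of the Euler-Maclaurin formula: if \<open>B\<close> is the Bernoulli polynomial, then \<open>f' B - f B'\<close> is a
  primitive of \<open>f'' B - 2 f\<close>, because \<open>B'' = 2\<close>.
\<close>
lemma has_integral_deriv2_cos_series:
  fixes f f1 f2 :: "real \<Rightarrow> complex"
  assumes f: "\<And>x. (f has_vector_derivative f1 x) (at x)" "\<And>x. (f1 has_vector_derivative f2 x) (at x)"
  shows "((\<lambda>x. f2 x * of_real (cos_series x / pi\<^sup>2) - 2 * f x) has_integral
     (f1 (of_int n + 1) / 6 - f (of_int n + 1) - f1 (of_int n) / 6 - f (of_int n))) {of_int n..of_int n + 1}"
proof -
  define b where "b = (\<lambda>x. (x - of_int n)\<^sup>2 - (x - of_int n) + 1/6 :: real)"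
  define b1 where "b1 = (\<lambda>x. 2 * (x - of_int n) - 1 :: real)"
  define H where "H = (\<lambda>x. f1 x * of_real (b x) - f x * of_real (b1 x))"
  have b: "((\<lambda>x. complex_of_real (b x)) has_vector_derivative of_real (b1 x)) (at x)" for x
    unfolding b_def b1_def
    by (intro has_vector_derivative_of_real) (auto intro!: derivative_eq_intros simp: has_real_derivative_iff_has_vector_derivative[symmetric])
  have b1: "((\<lambda>x. complex_of_real (b1 x)) has_vector_derivative of_real 2) (at x)" for x
    unfolding b1_def
    by (intro has_vector_derivative_of_real) (auto intro!: derivative_eq_intros simp: has_real_derivative_iff_has_vector_derivative[symmetric])
  have "((\<lambda>x. f2 x * of_real (b x) - 2 * f x) has_integral (H (of_int n + 1) - H (of_int n))) {of_int n..of_int n + 1}"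
  proof (rule fundamental_theorem_of_calculus)
    fix x
    have "(H has_vector_derivative (f1 x * of_real (b1 x) + f2 x * of_real (b x)) - (f x * of_real 2 + f1 x * of_real (b1 x))) (at x)"
      unfolding H_def by (intro has_vector_derivative_diff has_vector_derivative_mult f b b1)
    then show "(H has_vector_derivative f2 x * of_real (b x) - 2 * f x) (at x within {of_int n..of_int n + 1})"
      by (rule has_vector_derivative_at_within[OF has_vector_derivative_eq_rhs]) (simp add: algebra_simps)
  qed simp
  also have "H (of_int n + 1) - H (of_int n) = f1 (of_int n + 1) / 6 - f (of_int n + 1) - f1 (of_int n) / 6 - f (of_int n)"
    by (simp add: H_def b_def b1_def)
  finally show ?thesis
  proof (rule has_integral_eq[rotated])
    fix x assume "x \<in> {real_of_int n..of_int n + 1}"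
    then have "b x = cos_series x / pi\<^sup>2" by (simp add: cos_series_int_shift b_def)
    then show "f2 x * of_real (b x) - 2 * f x = f2 x * of_real (cos_series x / pi\<^sup>2) - 2 * f x" by simp
  qed
qed

text \<open>
  The hypotheses under which Poisson summation is proved; the second derivative is carried along as a
  parameter because both sides are expressed through it.
\<close>
locale poisson =
  fixes f f1 f2 :: "real \<Rightarrow> complex" and C :: real
  assumes deriv: "\<And>x. (f has_vector_derivative f1 x) (at x)" "\<And>x. (f1 has_vector_derivative f2 x) (at x)"
    and cont: "continuous_on UNIV f2"
    and decay: "\<And>x. norm (f x) \<le> C / (1 + x\<^sup>2)" "\<And>x. norm (f1 x) \<le> C / (1 + x\<^sup>2)" "\<And>x. norm (f2 x) \<le> C / (1 + x\<^sup>2)"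
begin

lemma cont_f: "continuous_on UNIV f" "continuous_on UNIV f1"
  using has_vector_derivative_continuous[OF deriv(1)] has_vector_derivative_continuous[OF deriv(2)]
  by (simp_all add: continuous_on_eq_continuous_at)

lemma integrable_f: "integrable lborel f" "integrable lborel f2"
  by (rule integrable_of_inverse_square_decay[OF cont_f(1) decay(1)]
      integrable_of_inverse_square_decay[OF cont decay(3)])+

lemma integrable_mult_bounded:
  assumes "continuous_on UNIV g" "\<And>x. norm (g x) \<le> B"
  shows "integrable lborel (\<lambda>x. f2 x * g x)"
proof (rule integrable_of_inverse_square_decay)
  show "continuous_on UNIV (\<lambda>x. f2 x * g x)" by (intro continuous_on_mult cont assms)
  fix x
  have "norm (f2 x * g x) \<le> C / (1 + x\<^sup>2) * B"
    unfolding norm_mult using decay(3)[of x] by (intro mult_mono assms order_trans[OF norm_ge_zero decay(3)]) auto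
  then show "norm (f2 x * g x) \<le> (C * B) / (1 + x\<^sup>2)" by simp
qed

text \<open>
  Adding up unit intervals, the boundary values of \<open>f\<close> combine to the sum over the integers and those
  of \<open>f'\<close> telescope, since the periodic Bernoulli polynomial is continuous.
\<close>
lemma euler_maclaurin:
  "((\<lambda>x. f2 x * of_real (cos_series x / pi\<^sup>2) - 2 * f x) has_integral
     ((f1 (real m) - f1 (- real m)) / 6 + f (real m) + f (- real m) - 2 * (\<Sum>n\<in>{- int m..int m}. f (of_int n))))
     {- real m..real m}"
proof (induction m)
  case 0
  show ?case using has_integral_refl(2)[of _ "0::real"] by simp
next
  case (Suc m)
  let ?u = "\<lambda>x. f2 x * of_real (cos_series x / pi\<^sup>2) - 2 * f x"
  have 1: "(?u has_integral (f1 (real m + 1) / 6 - f (real m + 1) - f1 (real m) / 6 - f (real m))) {real m..real m + 1}"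
    using has_integral_deriv2_cos_series[OF deriv, of "int m"] by simp
  have 2: "(?u has_integral (f1 (- real m) / 6 - f (- real m) - f1 (- real m - 1) / 6 - f (- real m - 1))) {- real m - 1..- real m}"
    using has_integral_deriv2_cos_series[OF deriv, of "- int m - 1"] by simp
  have e: "real (Suc m) = real m + 1" "- (real m + 1) = - real m - 1"
    "real_of_int (int m + 1) = real m + 1" "real_of_int (- int m - 1) = - real m - 1" by simp_all
  from has_integral_combine[OF _ _ 2 has_integral_combine[OF _ _ Suc 1]]
  show ?case
    unfolding sum_int_symmetric_Suc e by (rule has_integral_eq_rhs) (simp_all add: algebra_simps diff_divide_distrib)
qed

lemma summable_f: "(\<lambda>n::int. f (of_int n)) summable_on UNIV"
  by (rule summable_on_int_of_decay[OF decay(1)])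

lemma integrable_cos_series: "integrable lborel (\<lambda>x. f2 x * of_real (cos_series x))"
proof (rule integrable_mult_bounded)
  show "continuous_on UNIV (\<lambda>x. complex_of_real (cos_series x))"
    by (intro continuous_on_of_real continuous_on_cos_series)
  show "norm (complex_of_real (cos_series x)) \<le> pi\<^sup>2 / 6" for x
    unfolding norm_of_real by (rule cos_series_bound)
qed

lemma integral_cos_series:
  "(LINT x|lborel. f2 x * of_real (cos_series x)) = 
     of_real (2 * pi\<^sup>2) * ((LINT x|lborel. f x) - (\<Sum>\<^sub>\<infinity>n::int. f (of_int n)))"
proof -
  define u where "u = (\<lambda>x. f2 x * of_real (cos_series x / pi\<^sup>2) - 2 * f x)"
  have u_eq: "u = (\<lambda>x. (f2 x * of_real (cos_series x)) / of_real (pi\<^sup>2) - 2 * f x)"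
    by (simp add: u_def fun_eq_iff)
  have u: "integrable lborel u"
    unfolding u_eq
    by (intro Bochner_Integration.integrable_diff integrable_divide integrable_mult_right integrable_cos_series integrable_f)
  have "(\<lambda>m::nat. LINT x:{- real m..real m}|lborel. u x) \<longlonglongrightarrow> (LINT x|lborel. u x)"
    unfolding set_lebesgue_integral_def
  proof (rule integral_dominated_convergence)
    show "integrable lborel (\<lambda>x. norm (u x))" using u by (rule integrable_norm)
    show "AE x in lborel. (\<lambda>m::nat. indicat_real {- real m..real m} x *\<^sub>R u x) \<longlonglongrightarrow> u x"
    proof (intro AE_I2 tendsto_eventually)
      fix x
      obtain M :: nat where "\<bar>x\<bar> \<le> real M" using real_arch_simple by blast
      then show "\<forall>\<^sub>F m in sequentially. indicat_real {- real m..real m} x *\<^sub>R u x = u x"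
        unfolding eventually_sequentially by (intro exI[of _ M]) (auto simp: indicator_def)
    qed
  qed (use u in \<open>auto simp: indicator_def\<close>)
  moreover have "(LINT x:{- real m..real m}|lborel. u x) = 
     (f1 (real m) - f1 (- real m)) / 6 + f (real m) + f (- real m) - 2 * (\<Sum>n\<in>{- int m..int m}. f (of_int n))" for m
  proof -
    have "set_integrable lborel {- real m..real m} u"
      unfolding set_integrable_def by (rule integrable_mult_indicator[OF _ u]) simp
    from set_borel_integral_eq_integral(2)[OF this] show ?thesis
      using integral_unique[OF euler_maclaurin] by (simp add: u_def)
  qed
  moreover have "(\<lambda>m::nat. (f1 (real m) - f1 (- real m)) / 6 + f (real m) + f (- real m) - 2 * (\<Sum>n\<in>{- int m..int m}. f (of_int n)))
     \<longlonglongrightarrow> (0 - 0) / 6 + 0 + 0 - 2 * (\<Sum>\<^sub>\<infinity>n::int. f (of_int n))"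
  proof (intro tendsto_intros has_sum_int_symmetric_limit has_sum_infsum summable_f)
    have *: "filterlim (\<lambda>m::nat. real m) at_infinity sequentially" "filterlim (\<lambda>m::nat. - real m) at_infinity sequentially"
      by (simp_all add: filterlim_at_top_imp_at_infinity filterlim_real_sequentially
          filterlim_at_infinity_imp_norm_at_top filterlim_norm_at_top_imp_at_infinity)
    show "(\<lambda>m. f1 (real m)) \<longlonglongrightarrow> 0" "(\<lambda>m. f1 (- real m)) \<longlonglongrightarrow> 0"
      "(\<lambda>m. f (real m)) \<longlonglongrightarrow> 0" "(\<lambda>m. f (- real m)) \<longlonglongrightarrow> 0"
      using filterlim_compose[OF tendsto_0_of_inverse_square_decay[OF decay(1)]] 
        filterlim_compose[OF tendsto_0_of_inverse_square_decay[OF decay(2)]] * by blast+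
  qed simp
  ultimately have "(LINT x|lborel. u x) = - 2 * (\<Sum>\<^sub>\<infinity>n::int. f (of_int n))"
    using LIMSEQ_unique by fastforce
  moreover have "(LINT x|lborel. u x) = (LINT x|lborel. f2 x * of_real (cos_series x)) / of_real (pi\<^sup>2) - 2 * (LINT x|lborel. f x)"
    unfolding u_eq
    by (subst Bochner_Integration.integral_diff)
       (auto intro!: integrable_divide integrable_cos_series integrable_f)
  ultimately show ?thesis by (simp add: field_simps)
qed

definition fourier :: "int \<Rightarrow> complex" where
  "fourier k = (LINT x|lborel. f x * cis (- 2 * pi * of_int k * x))"

lemma fourier_by_parts:
  assumes "k \<noteq> 0"
  shows "fourier k = - (LINT x|lborel. f2 x * cis (- 2 * pi * of_int k * x)) / of_real (4 * pi\<^sup>2 * (of_int k)\<^sup>2)"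
proof -
  have "(- 2 * pi * real_of_int k)\<^sup>2 = 4 * pi\<^sup>2 * (of_int k)\<^sup>2" by (simp add: power_mult_distrib)
  then show ?thesis
    using integral_cis_by_parts[OF deriv cont decay, of "- 2 * pi * of_int k"] assms
    by (simp add: fourier_def field_simps)
qed

lemma summable_fourier: "fourier summable_on UNIV"
proof (rule summable_on_int)
  fix k :: int assume k: "k \<noteq> 0"
  let ?I = "LINT x|lborel. f2 x * cis (- 2 * pi * of_int k * x)"
  have "norm ?I \<le> (LINT x|lborel. norm (f2 x))"
    using integral_norm_bound[of lborel "\<lambda>x. f2 x * cis (- 2 * pi * of_int k * x)"] by (simp add: norm_mult)
  moreover have "norm (fourier k) = norm ?I / (4 * pi\<^sup>2 * (of_int k)\<^sup>2)"
    unfolding fourier_by_parts[OF k] norm_divide norm_minus_cancel norm_of_real by simp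
  ultimately have "norm (fourier k) \<le> (LINT x|lborel. norm (f2 x)) / (4 * pi\<^sup>2 * (of_int k)\<^sup>2)"
    by (simp add: divide_right_mono)
  then show "norm (fourier k) \<le> ((LINT x|lborel. norm (f2 x)) / (4 * pi\<^sup>2)) / (of_int k)\<^sup>2"
    by (simp add: field_simps)
qed

text \<open>
  The terms \<open>k\<close> and \<open>-k\<close> combine to a cosine, so that the symmetric partial sums are integrals against
  the partial sums of the Bernoulli Fourier series.
\<close>
lemma sum_fourier:
  "(\<Sum>k\<in>{- int n..int n}. fourier k) = (LINT x|lborel. f x) - 
     (LINT x|lborel. f2 x * of_real (\<Sum>k<n. cos (2 * pi * (real k + 1) * x) / (real k + 1)\<^sup>2)) / of_real (2 * pi\<^sup>2)"
proof (induction n)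
  case 0
  show ?case by (simp add: fourier_def)
next
  case (Suc n)
  let ?c = "\<lambda>x. cos (2 * pi * (real n + 1) * x) / (real n + 1)\<^sup>2"
  have i: "integrable lborel (\<lambda>x. f2 x * cis (t * x))" for t
    by (rule integrable_mult_bounded[of _ 1]) (auto intro!: continuous_intros)
  have "fourier (int n + 1) + fourier (- int n - 1) =
     - ((LINT x|lborel. f2 x * cis (- 2 * pi * (real n + 1) * x)) + (LINT x|lborel. f2 x * cis (2 * pi * (real n + 1) * x))) / of_real (4 * pi\<^sup>2 * (real n + 1)\<^sup>2)"
  proof -
    have "fourier (int n + 1) = - (LINT x|lborel. f2 x * cis (- 2 * pi * (real n + 1) * x)) / of_real (4 * pi\<^sup>2 * (real n + 1)\<^sup>2)"
      by (subst fourier_by_parts) simp_all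
    moreover have "(real_of_int (- int n - 1))\<^sup>2 = (real n + 1)\<^sup>2" "- 2 * pi * real_of_int (- int n - 1) = 2 * pi * (real n + 1)"
      by (simp_all add: power2_eq_square algebra_simps)
    then have "fourier (- int n - 1) = - (LINT x|lborel. f2 x * cis (2 * pi * (real n + 1) * x)) / of_real (4 * pi\<^sup>2 * (real n + 1)\<^sup>2)"
      by (subst fourier_by_parts) (linarith, simp only:)
    ultimately show ?thesis by (simp only: add_divide_distrib minus_add_distrib)
  qed
  also have "(LINT x|lborel. f2 x * cis (- 2 * pi * (real n + 1) * x)) + (LINT x|lborel. f2 x * cis (2 * pi * (real n + 1) * x))
     = (LINT x|lborel. f2 x * cis (- 2 * pi * (real n + 1) * x) + f2 x * cis (2 * pi * (real n + 1) * x))"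
    using i by (intro Bochner_Integration.integral_add[symmetric]) 
  also have "\<dots> = (LINT x|lborel. of_real (2 * (real n + 1)\<^sup>2) * (f2 x * of_real (?c x)))"
  proof (rule Bochner_Integration.integral_cong[OF refl])
    fix x
    have "cis (- 2 * pi * (real n + 1) * x) + cis (2 * pi * (real n + 1) * x) = of_real (2 * cos (2 * pi * (real n + 1) * x))"
      by (simp add: complex_eq_iff)
    then show "f2 x * cis (- 2 * pi * (real n + 1) * x) + f2 x * cis (2 * pi * (real n + 1) * x) = of_real (2 * (real n + 1)\<^sup>2) * (f2 x * of_real (?c x))"
      unfolding distrib_left[symmetric] by (simp add: add_eq_0_iff complex_eq_iff)
  qed
  also have "\<dots> = of_real (2 * (real n + 1)\<^sup>2) * (LINT x|lborel. f2 x * of_real (?c x))"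
    by simp
  also have "- (of_real (2 * (real n + 1)\<^sup>2) * (LINT x|lborel. f2 x * of_real (?c x))) / of_real (4 * pi\<^sup>2 * (real n + 1)\<^sup>2)
    = - (LINT x|lborel. f2 x * of_real (?c x)) / of_real (2 * pi\<^sup>2)"
  proof -
    have "(real n + 1)\<^sup>2 \<noteq> 0" by simp
    have "- (of_real (2 * N) * J) / of_real (4 * pi\<^sup>2 * N) = - J / of_real (2 * pi\<^sup>2)" if "N \<noteq> 0" for N :: real and J :: complex
      using that by (simp add: field_simps)
    from this[OF \<open>(real n + 1)\<^sup>2 \<noteq> 0\<close>] show ?thesis .
  qed
  finally have *: "fourier (int n + 1) + fourier (- int n - 1) = - (LINT x|lborel. f2 x * of_real (?c x)) / of_real (2 * pi\<^sup>2)" .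
  have ic: "integrable lborel (\<lambda>x. f2 x * of_real (?c x))"
  proof (rule integrable_mult_bounded)
    show "continuous_on UNIV (\<lambda>x. complex_of_real (?c x))"
      by (intro continuous_intros) simp
    have "1 \<le> (real n + 1)\<^sup>2" by (intro one_le_power) simp
    then have "\<bar>?c x\<bar> \<le> 1" for x
      using order_trans[OF abs_cos_le_one, of "(real n + 1)\<^sup>2" "2 * pi * (real n + 1) * x"] by (simp add: abs_divide)
    then show "norm (complex_of_real (?c x)) \<le> 1" for x unfolding norm_of_real .
  qed
  have isum: "integrable lborel (\<lambda>x. f2 x * of_real (\<Sum>k<n. cos (2 * pi * (real k + 1) * x) / (real k + 1)\<^sup>2))"
  proof (rule integrable_mult_bounded)
    show "continuous_on UNIV (\<lambda>x. complex_of_real (\<Sum>k<n. cos (2 * pi * (real k + 1) * x) / (real k + 1)\<^sup>2))"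
      by (intro continuous_intros) simp
    show "norm (complex_of_real (\<Sum>k<n. cos (2 * pi * (real k + 1) * x) / (real k + 1)\<^sup>2)) \<le> pi\<^sup>2 / 6" for x
      unfolding norm_of_real by (rule cos_series_partial_bound)
  qed
  have "(LINT x|lborel. f2 x * of_real (\<Sum>k<Suc n. cos (2 * pi * (real k + 1) * x) / (real k + 1)\<^sup>2)) =
     (LINT x|lborel. f2 x * of_real (\<Sum>k<n. cos (2 * pi * (real k + 1) * x) / (real k + 1)\<^sup>2) + f2 x * of_real (?c x))"
    by (simp only: sum.lessThan_Suc of_real_add distrib_left)
  also have "\<dots> = (LINT x|lborel. f2 x * of_real (\<Sum>k<n. cos (2 * pi * (real k + 1) * x) / (real k + 1)\<^sup>2)) + (LINT x|lborel. f2 x * of_real (?c x))"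
    by (rule Bochner_Integration.integral_add[OF isum ic])
  finally show ?case
    unfolding sum_int_symmetric_Suc add.assoc * Suc by (simp only:) (simp add: diff_divide_distrib add_divide_distrib del: of_real_sum)
qed

theorem poisson_summation: "(fourier has_sum (\<Sum>\<^sub>\<infinity>n::int. f (of_int n))) UNIV"
proof -
  have "(\<lambda>n. LINT x|lborel. f2 x * of_real (\<Sum>k<n. cos (2 * pi * (real k + 1) * x) / (real k + 1)\<^sup>2))
      \<longlonglongrightarrow> (LINT x|lborel. f2 x * of_real (cos_series x))"
  proof (rule integral_dominated_convergence)
    show "integrable lborel (\<lambda>x. norm (f2 x) * (pi\<^sup>2 / 6))"
      by (intro integrable_mult_left integrable_norm integrable_f)
    show "AE x in lborel. (\<lambda>n. f2 x * of_real (\<Sum>k<n. cos (2 * pi * (real k + 1) * x) / (real k + 1)\<^sup>2)) \<longlonglongrightarrow> f2 x * of_real (cos_series x)"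
      by (intro AE_I2 tendsto_mult tendsto_const tendsto_of_real tendsto_uniform_limitI[OF cos_series_uniform]) auto
    show "AE x in lborel. norm (f2 x * of_real (\<Sum>k<n. cos (2 * pi * (real k + 1) * x) / (real k + 1)\<^sup>2)) \<le> norm (f2 x) * (pi\<^sup>2 / 6)" for n
      unfolding norm_mult norm_of_real by (intro AE_I2 mult_left_mono cos_series_partial_bound) auto
    show "(\<lambda>x. f2 x * of_real (cos_series x)) \<in> borel_measurable lborel"
      using integrable_cos_series by (rule borel_measurable_integrable)
    show "(\<lambda>x. f2 x * of_real (\<Sum>k<n. cos (2 * pi * (real k + 1) * x) / (real k + 1)\<^sup>2)) \<in> borel_measurable lborel" for n
      using borel_measurable_integrable[OF integrable_f(2)] by measurable
  qed
  then have "(\<lambda>n::nat. \<Sum>k\<in>{- int n..int n}. fourier k) \<longlonglongrightarrow> 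
      (LINT x|lborel. f x) - (LINT x|lborel. f2 x * of_real (cos_series x)) / of_real (2 * pi\<^sup>2)"
    unfolding sum_fourier by (intro tendsto_diff tendsto_divide tendsto_const) auto
  moreover have "(LINT x|lborel. f x) - (LINT x|lborel. f2 x * of_real (cos_series x)) / of_real (2 * pi\<^sup>2) = (\<Sum>\<^sub>\<infinity>n::int. f (of_int n))"
    unfolding integral_cos_series by simp
  ultimately have "(\<lambda>n::nat. \<Sum>k\<in>{- int n..int n}. fourier k) \<longlonglongrightarrow> (\<Sum>\<^sub>\<infinity>n::int. f (of_int n))" by simp
  moreover have "(\<lambda>n::nat. \<Sum>k\<in>{- int n..int n}. fourier k) \<longlonglongrightarrow> infsum fourier UNIV"
    by (intro has_sum_int_symmetric_limit has_sum_infsum summable_fourier)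
  ultimately show ?thesis using has_sum_infsum[OF summable_fourier] LIMSEQ_unique by metis
qed

end

section \<open>Gaussians and the uniqueness of delta series\<close>

lemma bounded_power_gaussian:
  assumes t: "t > 0"
  shows "bounded (range (\<lambda>y::real. y ^ k * exp (- t * y\<^sup>2)))"
proof -
  have "\<bar>y ^ k * exp (- t * y\<^sup>2)\<bar> \<le> 1 + fact k / t ^ k" for y :: real
  proof -
    have "\<bar>y\<bar> ^ k \<le> 1 + (y\<^sup>2) ^ k"
    proof (cases "\<bar>y\<bar> \<le> 1")
      case True
      then have "\<bar>y\<bar> ^ k \<le> 1" by (intro power_le_one) auto
      then show ?thesis by (simp add: add_increasing2)
    next
      case False
      then have "\<bar>y\<bar> ^ k \<le> \<bar>y\<bar> ^ (2 * k)" by (intro power_increasing) auto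
      then show ?thesis by (simp add: power_mult)
    qed
    moreover have "(y\<^sup>2) ^ k \<le> fact k / t ^ k * exp (t * y\<^sup>2)"
    proof -
      have "(t * y\<^sup>2) ^ k /\<^sub>R fact k \<le> exp (t * y\<^sup>2)"
        unfolding exp_def using t
        by (intro sum_le_suminf[of _ "{k}", simplified] summable_exp_generic ballI) auto
      then show ?thesis using t by (simp add: field_simps power_mult_distrib)
    qed
    ultimately have "\<bar>y\<bar> ^ k * exp (- t * y\<^sup>2) \<le> (1 + fact k / t ^ k * exp (t * y\<^sup>2)) * exp (- t * y\<^sup>2)"
      by (intro mult_right_mono) auto
    also have "\<dots> = exp (- t * y\<^sup>2) + fact k / t ^ k"
      by (simp add: algebra_simps exp_minus divide_simps)
    also have "\<dots> \<le> 1 + fact k / t ^ k" using t by simp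
    finally show ?thesis by (simp add: abs_mult power_abs)
  qed
  then show ?thesis unfolding bounded_iff by auto
qed

text \<open>
  The extra power \<open>y ^ k\<close> makes the statement inductive in the polynomial.
\<close>
lemma bounded_poly_gaussian:
  assumes "t > 0"
  shows "bounded (range (\<lambda>y::real. y ^ k * poly p y * exp (- t * y\<^sup>2)))"
proof (induction p arbitrary: k)
  case 0
  show ?case by simp
next
  case (pCons a p)
  have "bounded (range (\<lambda>y. a * (y ^ k * exp (- t * y\<^sup>2))))"
    using bounded_scaling[OF bounded_power_gaussian[OF assms, of k], of a] by (simp add: image_image)
  from bounded_plus_comp[OF this pCons.IH[of "Suc k"]] show ?case
    by (simp add: algebra_simps)
qed

definition gaussian :: "real \<Rightarrow> real \<Rightarrow> real \<Rightarrow> complex" where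
  "gaussian t x0 x = of_real (exp (- t * (x - x0)\<^sup>2))"

lemma iter_deriv_0: "iter_deriv 0 f = f"
  and iter_deriv_Suc: "iter_deriv (Suc n) f = (\<lambda>x. vector_derivative (iter_deriv n f) (at x))"
  by (simp_all add: iter_deriv_def)

lemma iter_deriv_gaussian:
  "\<exists>p. iter_deriv n (gaussian t x0) = (\<lambda>x. of_real (poly p (x - x0) * exp (- t * (x - x0)\<^sup>2)))"
proof (induction n)
  case 0
  show ?case by (intro exI[of _ 1]) (simp add: iter_deriv_0 gaussian_def fun_eq_iff)
next
  case (Suc n)
  then obtain p where p: "iter_deriv n (gaussian t x0) = (\<lambda>x. of_real (poly p (x - x0) * exp (- t * (x - x0)\<^sup>2)))" by blast
  let ?q = "pderiv p + [:0, - 2 * t:] * p"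
  have "((\<lambda>x. complex_of_real (poly p (x - x0) * exp (- t * (x - x0)\<^sup>2))) has_vector_derivative
     of_real (poly ?q (x - x0) * exp (- t * (x - x0)\<^sup>2))) (at x)" for x
    by (intro has_vector_derivative_of_real)
       (auto intro!: derivative_eq_intros DERIV_chain2[OF poly_DERIV] simp: has_real_derivative_iff_has_vector_derivative[symmetric] algebra_simps)
  then have "iter_deriv (Suc n) (gaussian t x0) = (\<lambda>x. of_real (poly ?q (x - x0) * exp (- t * (x - x0)\<^sup>2)))"
    unfolding iter_deriv_Suc p by (intro ext vector_derivative_at)
  then show ?case by blast
qed

lemma schwartz_gaussian:
  assumes "t > 0"
  shows "schwartz (gaussian t x0)"
  unfolding schwartz_def
proof (intro conjI allI)
  fix n k :: nat and x :: real
  obtain p where p: "iter_deriv n (gaussian t x0) = (\<lambda>x. of_real (poly p (x - x0) * exp (- t * (x - x0)\<^sup>2)))"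
    using iter_deriv_gaussian by blast
  have "((\<lambda>x. poly p (x - x0) * exp (- t * (x - x0)\<^sup>2)) has_real_derivative
     poly (pderiv p) (x - x0) * exp (- t * (x - x0)\<^sup>2) + exp (- t * (x - x0)\<^sup>2) * (- t * (2 * (x - x0))) * poly p (x - x0)) (at x)"
    by (auto intro!: derivative_eq_intros DERIV_chain2[OF poly_DERIV])
  then have "((\<lambda>x. complex_of_real (poly p (x - x0) * exp (- t * (x - x0)\<^sup>2))) has_vector_derivative
     of_real (poly (pderiv p) (x - x0) * exp (- t * (x - x0)\<^sup>2) + exp (- t * (x - x0)\<^sup>2) * (- t * (2 * (x - x0))) * poly p (x - x0))) (at x)"
    by (intro has_vector_derivative_of_real) (simp add: has_real_derivative_iff_has_vector_derivative)
  then show "iter_deriv n (gaussian t x0) differentiable (at x)"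
    unfolding p by (rule differentiableI_vector)
  let ?P = "pcompose ([:0, 1:] ^ k) [:x0, 1:] * p"
  have "bounded (range (\<lambda>x. x ^ k * (poly p (x - x0) * exp (- t * (x - x0)\<^sup>2))))"
  proof (rule bounded_subset[OF bounded_poly_gaussian[OF assms, of 0 ?P]], clarify)
    fix x
    show "x ^ k * (poly p (x - x0) * exp (- t * (x - x0)\<^sup>2)) \<in> range (\<lambda>y. y ^ 0 * poly ?P y * exp (- t * y\<^sup>2))"
      by (rule image_eqI[of _ _ "x - x0"]) (simp_all add: poly_pcompose)
  qed
  then have "bounded (complex_of_real ` range (\<lambda>x. x ^ k * (poly p (x - x0) * exp (- t * (x - x0)\<^sup>2))))"
    by (rule bounded_linear_image) (rule bounded_linear_of_real)
  then show "bounded (range (\<lambda>x. x ^ k *\<^sub>R iter_deriv n (gaussian t x0) x))"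
    unfolding p by (simp add: image_image scaleR_conv_of_real)
qed

text \<open>
  The difference \<open>u\<close> of two weight functions pairs to zero with every Gaussian centred at \<open>x0\<close>.  The
  other points of its support keep a distance \<open>d > 0\<close> from \<open>x0\<close>, so as the Gaussian narrows their
  contribution decays like \<open>exp (- t d\<^sup>2)\<close> and only \<open>u x0\<close> is left.
\<close>
lemma is_delta_series_unique:
  assumes w: "is_delta_series T w" and v: "is_delta_series T v"
  shows "w = v"
proof
  fix x0
  define u where "u = (\<lambda>x. w x - v x)"
  have sum0: "((\<lambda>x. u x * gaussian t x0 x) has_sum 0) UNIV" if "t > 0" for t
  proof -
    have "((\<lambda>x. w x * gaussian t x0 x) has_sum T (gaussian t x0)) UNIV"
      "((\<lambda>x. v x * gaussian t x0 x) has_sum T (gaussian t x0)) UNIV"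
      using w v schwartz_gaussian[OF that, of x0] by (auto simp: is_delta_series_def)
    from has_sum_add[OF this(1) has_sum_uminusI[OF this(2)]] show ?thesis
      by (simp add: u_def algebra_simps)
  qed
  have "\<exists>d>0. \<forall>x. x \<noteq> x0 \<longrightarrow> u x \<noteq> 0 \<longrightarrow> d \<le> \<bar>x - x0\<bar>"
  proof -
    define S where "S = {x \<in> {- (\<bar>x0\<bar> + 1)..\<bar>x0\<bar> + 1}. u x \<noteq> 0} - {x0}"
    have "S \<subseteq> {x \<in> {- (\<bar>x0\<bar> + 1)..\<bar>x0\<bar> + 1}. w x \<noteq> 0} \<union> {x \<in> {- (\<bar>x0\<bar> + 1)..\<bar>x0\<bar> + 1}. v x \<noteq> 0}"
      by (auto simp: S_def u_def)
    then have "finite S"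
      using w v unfolding is_delta_series_def by (meson finite_UnI finite_subset)
    then obtain d where d: "d > 0" "\<And>x. x \<in> S \<Longrightarrow> x \<noteq> x0 \<Longrightarrow> d \<le> dist x0 x"
      using finite_set_avoid[of S x0] by blast
    show ?thesis
    proof (intro exI[of _ "min d 1"] conjI allI impI)
      fix x assume "x \<noteq> x0" "u x \<noteq> 0"
      then show "min d 1 \<le> \<bar>x - x0\<bar>"
        using d(2)[of x] by (cases "x \<in> S") (auto simp: S_def dist_real_def)
    qed (use d in auto)
  qed
  then obtain d where d: "d > 0" "\<And>x. x \<noteq> x0 \<Longrightarrow> u x \<noteq> 0 \<Longrightarrow> d \<le> \<bar>x - x0\<bar>" by blast
  \<comment> \<open>convergent complex series converge absolutely, which gives a dominating series for all widths\<close>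
  define A where "A = (\<lambda>x. norm (u x * gaussian 1 x0 x))"
  have A: "A summable_on UNIV - {x0}"
  proof (rule summable_on_subset_banach)
    have "(\<lambda>x. u x * gaussian 1 x0 x) summable_on UNIV"
      by (rule has_sum_imp_summable[OF sum0]) simp
    then show "A summable_on UNIV"
      unfolding A_def by (simp only: summable_on_iff_abs_summable_on_complex)
  qed simp
  have bound: "norm (u x0) \<le> exp (- t * d\<^sup>2) * infsum A (UNIV - {x0})" if t: "t > 0" for t
  proof -
    have "((\<lambda>x. u x * gaussian (1 + t) x0 x) has_sum (0 - u x0)) (UNIV - {x0})"
    proof (rule has_sum_Diff)
      show "((\<lambda>x. u x * gaussian (1 + t) x0 x) has_sum u x0) {x0}"
        by (rule has_sum_finiteI) (simp_all add: gaussian_def)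
    qed (use sum0[of "1 + t"] t in simp_all)
    then have "norm (0 - u x0) \<le> exp (- t * d\<^sup>2) * infsum A (UNIV - {x0})"
    proof (rule norm_infsum_le)
      show "((\<lambda>x. exp (- t * d\<^sup>2) * A x) has_sum exp (- t * d\<^sup>2) * infsum A (UNIV - {x0})) (UNIV - {x0})"
        by (intro has_sum_cmult_right has_sum_infsum A)
      fix x assume x: "x \<in> UNIV - {x0}"
      show "norm (u x * gaussian (1 + t) x0 x) \<le> exp (- t * d\<^sup>2) * A x"
      proof (cases "u x = 0")
        case False
        then have "d \<le> \<bar>x - x0\<bar>" using x d(2) by auto
        then have "d\<^sup>2 \<le> (x - x0)\<^sup>2" using d(1) power_mono[of d "\<bar>x - x0\<bar>" 2] by simp
        then have "exp (- t * (x - x0)\<^sup>2) \<le> exp (- t * d\<^sup>2)" using t by simp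
        then have "exp (- t * (x - x0)\<^sup>2) * (norm (u x) * exp (- (x - x0)\<^sup>2)) \<le> exp (- t * d\<^sup>2) * (norm (u x) * exp (- (x - x0)\<^sup>2))"
          by (intro mult_right_mono) auto
        moreover have "exp (- (1 + t) * (x - x0)\<^sup>2) = exp (- t * (x - x0)\<^sup>2) * exp (- (x - x0)\<^sup>2)"
          unfolding exp_add[symmetric] by (simp add: algebra_simps)
        ultimately show ?thesis by (simp add: A_def gaussian_def norm_mult mult_ac)
      qed (simp add: A_def)
    qed
    then show ?thesis by simp
  qed
  have "(\<lambda>n. exp (- real n * d\<^sup>2) * infsum A (UNIV - {x0})) \<longlonglongrightarrow> 0 * infsum A (UNIV - {x0})"
  proof (intro tendsto_mult tendsto_const filterlim_compose[OF exp_at_bot])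
    have "filterlim (\<lambda>n. d\<^sup>2 * real n) at_top sequentially"
      by (rule filterlim_tendsto_pos_mult_at_top[OF tendsto_const _ filterlim_real_sequentially]) (use d in auto)
    then show "filterlim (\<lambda>n. - real n * d\<^sup>2) at_bot sequentially"
      by (simp add: filterlim_uminus_at_bot mult.commute)
  qed
  then have "(\<lambda>n. exp (- real n * d\<^sup>2) * infsum A (UNIV - {x0})) \<longlonglongrightarrow> 0" by simp
  moreover have "\<forall>\<^sub>F n in sequentially. norm (u x0) \<le> exp (- real n * d\<^sup>2) * infsum A (UNIV - {x0})"
    using eventually_gt_at_top[of 0] by eventually_elim (rule bound, simp)
  ultimately have "norm (u x0) \<le> 0" by (rule tendsto_lowerbound) simp
  then show "w x0 = v x0" by (simp add: u_def)
qed

lemma delta_weight_eq: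
  assumes "is_delta_series T w"
  shows "delta_weight T = w"
  unfolding delta_weight_def using assms is_delta_series_unique by (intro the_equality) auto

section \<open>Chirps times Schwartz functions\<close>

text \<open>
  The decay part of the Schwartz condition for a single function, without derivatives: this is what is
  stable under multiplication by functions of modulus one and by polynomials.
\<close>
definition rapidly_decreasing :: "(real \<Rightarrow> complex) \<Rightarrow> bool" where
  "rapidly_decreasing g \<longleftrightarrow> (\<forall>k. \<exists>C. \<forall>x. norm (g x) * \<bar>x\<bar> ^ k \<le> C)"

lemma rapidly_decreasing_add:
  assumes "rapidly_decreasing f" "rapidly_decreasing g"
  shows "rapidly_decreasing (\<lambda>x. f x + g x)"
  unfolding rapidly_decreasing_def
proof
  fix k
  obtain C D where C: "\<And>x. norm (f x) * \<bar>x\<bar> ^ k \<le> C" and D: "\<And>x. norm (g x) * \<bar>x\<bar> ^ k \<le> D"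
    using assms unfolding rapidly_decreasing_def by meson
  have "norm (f x + g x) * \<bar>x\<bar> ^ k \<le> C + D" for x
  proof -
    have "norm (f x + g x) * \<bar>x\<bar> ^ k \<le> (norm (f x) + norm (g x)) * \<bar>x\<bar> ^ k"
      by (intro mult_right_mono norm_triangle_ineq) auto
    then show ?thesis using C[of x] D[of x] by (simp add: distrib_right)
  qed
  then show "\<exists>C. \<forall>x. norm (f x + g x) * \<bar>x\<bar> ^ k \<le> C" by blast
qed

lemma rapidly_decreasing_le:
  assumes "rapidly_decreasing f" "\<And>x. norm (g x) \<le> A * (norm (f x) * \<bar>x\<bar> ^ j)"
  shows "rapidly_decreasing g"
  unfolding rapidly_decreasing_def
proof
  fix k
  obtain C where C: "\<And>x. norm (f x) * \<bar>x\<bar> ^ (j + k) \<le> C"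
    using assms(1) unfolding rapidly_decreasing_def by meson
  have "norm (g x) * \<bar>x\<bar> ^ k \<le> \<bar>A\<bar> * C" for x
  proof -
    have "norm (g x) \<le> \<bar>A\<bar> * (norm (f x) * \<bar>x\<bar> ^ j)"
      by (rule order_trans[OF assms(2)]) (intro mult_right_mono, auto)
    then have "norm (g x) * \<bar>x\<bar> ^ k \<le> \<bar>A\<bar> * (norm (f x) * \<bar>x\<bar> ^ j) * \<bar>x\<bar> ^ k"
      by (intro mult_right_mono) auto
    also have "\<dots> = \<bar>A\<bar> * (norm (f x) * \<bar>x\<bar> ^ (j + k))" by (simp add: power_add)
    also have "\<dots> \<le> \<bar>A\<bar> * C" by (intro mult_left_mono C) auto
    finally show ?thesis .
  qed
  then show "\<exists>C. \<forall>x. norm (g x) * \<bar>x\<bar> ^ k \<le> C" by blast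
qed

lemma rapidly_decreasing_affine_mult:
  assumes "rapidly_decreasing f"
  shows "rapidly_decreasing (\<lambda>x. (c * of_real x + d) * f x)"
proof -
  have "rapidly_decreasing (\<lambda>x. c * of_real x * f x)"
    by (rule rapidly_decreasing_le[OF assms, of _ "norm c" 1]) (simp add: norm_mult mult_ac)
  moreover have "rapidly_decreasing (\<lambda>x. d * f x)"
    by (rule rapidly_decreasing_le[OF assms, of _ "norm d" 0]) (simp add: norm_mult)
  ultimately show ?thesis using rapidly_decreasing_add by (simp add: distrib_right)
qed

lemma rapidly_decreasing_scale:
  assumes "rapidly_decreasing f" "h > 0"
  shows "rapidly_decreasing (\<lambda>x. f (h * x))"
  unfolding rapidly_decreasing_def
proof
  fix k
  obtain C where C: "\<And>x. norm (f x) * \<bar>x\<bar> ^ k \<le> C"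
    using assms(1) unfolding rapidly_decreasing_def by meson
  have "norm (f (h * x)) * \<bar>x\<bar> ^ k \<le> C / h ^ k" for x
    using C[of "h * x"] assms(2) by (simp add: abs_mult power_mult_distrib field_simps)
  then show "\<exists>C. \<forall>x. norm (f (h * x)) * \<bar>x\<bar> ^ k \<le> C" by blast
qed

lemma rapidly_decreasing_decay:
  assumes "rapidly_decreasing f"
  shows "\<exists>C. \<forall>x. norm (f x) \<le> C / (1 + x\<^sup>2)"
proof -
  obtain C D where C: "\<And>x. norm (f x) * \<bar>x\<bar> ^ 0 \<le> C" and D: "\<And>x. norm (f x) * \<bar>x\<bar> ^ 2 \<le> D"
    using assms unfolding rapidly_decreasing_def by meson
  have "norm (f x) \<le> (C + D) / (1 + x\<^sup>2)" for x
  proof -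
    have "norm (f x) * (1 + x\<^sup>2) \<le> C + D" using C[of x] D[of x] by (simp add: distrib_left)
    then show ?thesis by (subst pos_le_divide_eq) (auto simp: add_pos_nonneg)
  qed
  then show ?thesis by blast
qed

lemma schwartz_derivs:
  assumes "schwartz \<phi>"
  obtains \<phi>1 \<phi>2 where "\<And>x. (\<phi> has_vector_derivative \<phi>1 x) (at x)"
    "\<And>x. (\<phi>1 has_vector_derivative \<phi>2 x) (at x)" "continuous_on UNIV \<phi>2"
    "rapidly_decreasing \<phi>" "rapidly_decreasing \<phi>1" "rapidly_decreasing \<phi>2"
proof -
  have d: "(iter_deriv n \<phi> has_vector_derivative iter_deriv (Suc n) \<phi> x) (at x)" for n x
    using assms unfolding schwartz_def iter_deriv_Suc by (auto simp: vector_derivative_works[symmetric])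
  have r: "rapidly_decreasing (iter_deriv n \<phi>)" for n
    unfolding rapidly_decreasing_def
  proof
    fix k
    have "bounded (range (\<lambda>x. x ^ k *\<^sub>R iter_deriv n \<phi> x))" using assms by (simp add: schwartz_def)
    then show "\<exists>C. \<forall>x. norm (iter_deriv n \<phi> x) * \<bar>x\<bar> ^ k \<le> C"
      by (auto simp: bounded_iff power_abs mult.commute)
  qed
  have c: "continuous_on UNIV (iter_deriv n \<phi>)" for n
    using has_vector_derivative_continuous[OF d] by (simp add: continuous_on_eq_continuous_at)
  show thesis
    by (rule that[OF d[of 0, unfolded iter_deriv_0] d[of "Suc 0"] c r[of 0, unfolded iter_deriv_0] r r])
qed

text \<open>
  Each derivative of the chirp produces only an affine factor, which a rapidly decreasing function
  absorbs.
\<close>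
lemma poisson_chirp:
  assumes "schwartz \<phi>" "h > 0"
  shows "\<exists>f1 f2 C. poisson (\<lambda>x. cis (a * x\<^sup>2 + d * x) * \<phi> (h * x)) f1 f2 C"
proof -
  obtain \<phi>1 \<phi>2 where \<phi>: "\<And>x. (\<phi> has_vector_derivative \<phi>1 x) (at x)"
    "\<And>x. (\<phi>1 has_vector_derivative \<phi>2 x) (at x)" and c\<phi>2: "continuous_on UNIV \<phi>2"
    and rd: "rapidly_decreasing \<phi>" "rapidly_decreasing \<phi>1" "rapidly_decreasing \<phi>2"
    using schwartz_derivs[OF assms(1)] by blast
  define e where "e = (\<lambda>x. cis (a * x\<^sup>2 + d * x))"
  define l where "l = (\<lambda>x. (\<i> * of_real (2 * a)) * of_real x + \<i> * of_real d)"
  define u where "u = (\<lambda>x. \<phi> (h * x))"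
  define u1 where "u1 = (\<lambda>x. of_real h * \<phi>1 (h * x))"
  define u2 where "u2 = (\<lambda>x. of_real (h\<^sup>2) * \<phi>2 (h * x))"
  define v1 where "v1 = (\<lambda>x. l x * u x + u1 x)"
  define v2 where "v2 = (\<lambda>x. l x * v1 x + ((\<i> * of_real (2 * a)) * u x + l x * u1 x + u2 x))"
  have hx: "((\<lambda>x. h * x) has_vector_derivative h) (at x)" for x
    unfolding has_real_derivative_iff_has_vector_derivative[symmetric]
    by (auto intro!: derivative_eq_intros)
  have e: "(e has_vector_derivative l x * e x) (at x)" for x
  proof -
    have "((\<lambda>x. a * x\<^sup>2 + d * x) has_real_derivative 2 * a * x + d) (at x)"
      by (auto intro!: derivative_eq_intros)
    from has_vector_derivative_cis[OF this] show ?thesis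
      by (simp add: e_def l_def algebra_simps)
  qed
  have u: "(u has_vector_derivative u1 x) (at x)" for x
    using vector_diff_chain_at[OF hx \<phi>(1)] by (simp add: u_def u1_def o_def scaleR_conv_of_real)
  have u1: "(u1 has_vector_derivative u2 x) (at x)" for x
    using has_vector_derivative_mult_right[OF vector_diff_chain_at[OF hx \<phi>(2)], of "of_real h" x]
    by (simp add: u1_def u2_def o_def scaleR_conv_of_real power2_eq_square mult.assoc)
  have l: "(l has_vector_derivative \<i> * of_real (2 * a)) (at x)" for x
  proof -
    have "((\<lambda>x. (\<i> * of_real (2 * a)) * complex_of_real x + \<i> * of_real d) has_vector_derivative (\<i> * of_real (2 * a)) * of_real 1 + 0) (at x)"
      by (intro has_vector_derivative_add has_vector_derivative_mult_right has_vector_derivative_of_real has_vector_derivative_const)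
         (auto simp: has_real_derivative_iff_has_vector_derivative[symmetric])
    then show ?thesis by (simp add: l_def)
  qed
  have v1: "(v1 has_vector_derivative ((\<i> * of_real (2 * a)) * u x + l x * u1 x + u2 x)) (at x)" for x
  proof -
    have "(v1 has_vector_derivative (l x * u1 x + (\<i> * of_real (2 * a)) * u x) + u2 x) (at x)"
      unfolding v1_def by (intro has_vector_derivative_add has_vector_derivative_mult l u u1)
    then show ?thesis by (simp add: add_ac)
  qed
  have d1: "((\<lambda>x. e x * u x) has_vector_derivative e x * v1 x) (at x)" for x
    using has_vector_derivative_mult[OF e u, of x] by (simp add: v1_def algebra_simps)
  have d2: "((\<lambda>x. e x * v1 x) has_vector_derivative e x * v2 x) (at x)" for x
    using has_vector_derivative_mult[OF e v1, of x] by (simp add: v2_def algebra_simps)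
  have ru: "rapidly_decreasing u" unfolding u_def by (intro rapidly_decreasing_scale rd assms)
  have ru1: "rapidly_decreasing u1" unfolding u1_def
    using rapidly_decreasing_affine_mult[OF rapidly_decreasing_scale[OF rd(2) assms(2)], of 0] by simp
  have ru2: "rapidly_decreasing u2" unfolding u2_def
    using rapidly_decreasing_affine_mult[OF rapidly_decreasing_scale[OF rd(3) assms(2)], of 0 "of_real (h\<^sup>2)"] by simp
  have rl: "rapidly_decreasing (\<lambda>x. l x * g x)" if "rapidly_decreasing g" for g
    unfolding l_def by (rule rapidly_decreasing_affine_mult[OF that])
  have rv1: "rapidly_decreasing v1" unfolding v1_def by (intro rapidly_decreasing_add rl ru ru1)
  have rc: "rapidly_decreasing (\<lambda>x. c * u x)" for c
    using rapidly_decreasing_affine_mult[OF ru, of 0 c] by simp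
  have rv2: "rapidly_decreasing v2" unfolding v2_def by (intro rapidly_decreasing_add rl ru1 ru2 rv1 rc)
  obtain C0 C1 C2 where C: "\<And>x. norm (u x) \<le> C0 / (1 + x\<^sup>2)" "\<And>x. norm (v1 x) \<le> C1 / (1 + x\<^sup>2)" "\<And>x. norm (v2 x) \<le> C2 / (1 + x\<^sup>2)"
    using rapidly_decreasing_decay[OF ru] rapidly_decreasing_decay[OF rv1] rapidly_decreasing_decay[OF rv2] by blast
  define K where "K = max C0 (max C1 C2)"
  have K: "c / (1 + x\<^sup>2) \<le> K / (1 + x\<^sup>2)" if "c \<le> K" for c x :: real
    using that by (intro divide_right_mono) auto
  have "poisson (\<lambda>x. e x * u x) (\<lambda>x. e x * v1 x) (\<lambda>x. e x * v2 x) K"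
  proof
    have cont: "continuous_on UNIV g" if "\<And>x. (g has_vector_derivative g' x) (at x)" for g g' :: "real \<Rightarrow> complex"
      using has_vector_derivative_continuous[OF that] by (simp add: continuous_on_eq_continuous_at)
    have "continuous_on UNIV u2"
      unfolding u2_def by (intro continuous_intros continuous_on_compose2[OF c\<phi>2]) auto
    then show "continuous_on UNIV (\<lambda>x. e x * v2 x)"
      unfolding v2_def
      by (intro continuous_on_mult continuous_on_add continuous_on_const cont[OF e] cont[OF l] cont[OF u] cont[OF u1] cont[OF v1])
    fix x
    have ne: "norm (e x) = 1" by (simp add: e_def)
    show "norm (e x * u x) \<le> K / (1 + x\<^sup>2)" "norm (e x * v1 x) \<le> K / (1 + x\<^sup>2)" "norm (e x * v2 x) \<le> K / (1 + x\<^sup>2)"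
      unfolding norm_mult ne mult_1 by (rule order_trans[OF C(1) K] order_trans[OF C(2) K] order_trans[OF C(3) K]; simp add: K_def)+
  qed (rule d1 d2)+
  then show ?thesis unfolding e_def u_def by blast
qed

section \<open>The fractional Fourier transform of the Dirac comb\<close>

definition chirp_transform :: "real \<Rightarrow> (real \<Rightarrow> complex) \<Rightarrow> real \<Rightarrow> complex" where
  "chirp_transform q \<phi> \<xi> = (LINT y|lborel. cis (pi * q * y\<^sup>2 - 2 * pi * \<xi> * y) * \<phi> y)"

text \<open>
  Expanding the kernel separates the chirp in \<open>x\<close>, which leaves a Fourier transform at \<open>x/s\<close>.
\<close>
lemma frft_eq_chirp_transform:
  assumes s: "sin (pi * \<alpha> / 2) = s" "s \<noteq> 0" and c: "cos (pi * \<alpha> / 2) = q * s"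
  shows "frft \<alpha> \<phi> x = 1 / csqrt (\<i> * of_real s) * cis (pi * q * x\<^sup>2) * chirp_transform q \<phi> (x / s)"
proof -
  have "exp (of_real pi * \<i> / of_real s * of_real (q * s * (x\<^sup>2 + y\<^sup>2) - 2 * x * y))
     = cis (pi * q * x\<^sup>2) * cis (pi * q * y\<^sup>2 - 2 * pi * (x / s) * y)" for y
  proof -
    have "of_real pi * \<i> / of_real s * of_real (q * s * (x\<^sup>2 + y\<^sup>2) - 2 * x * y)
       = \<i> * of_real (pi / s * (q * s * (x\<^sup>2 + y\<^sup>2) - 2 * x * y))" by simp
    also have "pi / s * (q * s * (x\<^sup>2 + y\<^sup>2) - 2 * x * y) = pi * q * x\<^sup>2 + (pi * q * y\<^sup>2 - 2 * pi * (x / s) * y)"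
      using s(2) by (simp add: field_simps)
    finally show ?thesis unfolding cis_mult by (simp only: cis_conv_exp)
  qed
  then show ?thesis
    unfolding frft_def s c chirp_transform_def by (simp add: mult.assoc)
qed

text \<open>
  Poisson summation after rescaling by \<open>h\<close>; the parameter \<open>\<mu>\<close> shifts the frequencies and selects a
  residue class.
\<close>
lemma poisson_chirp_transform:
  fixes \<phi> :: "real \<Rightarrow> complex" and h q \<mu> :: real
  assumes \<phi>: "schwartz \<phi>" and h: "h > 0"
  defines "g \<equiv> \<lambda>n::int. cis (pi * q * (h * of_int n)\<^sup>2 - 2 * pi * \<mu> * of_int n) * \<phi> (h * of_int n)"
  shows "(g has_sum infsum g UNIV) UNIV"
    and "((\<lambda>k::int. chirp_transform q \<phi> ((\<mu> + of_int k) / h)) has_sum of_real h * infsum g UNIV) UNIV"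
proof -
  define f where "f = (\<lambda>x. cis (pi * q * h\<^sup>2 * x\<^sup>2 + (- 2 * pi * \<mu>) * x) * \<phi> (h * x))"
  obtain f1 f2 C where "poisson f f1 f2 C"
    using poisson_chirp[OF \<phi> h] unfolding f_def by blast
  then interpret poisson f f1 f2 C .
  have g: "g = (\<lambda>n. f (of_int n))"
    by (simp add: g_def f_def fun_eq_iff power_mult_distrib mult_ac)
  show "(g has_sum infsum g UNIV) UNIV"
    unfolding g by (rule has_sum_infsum[OF summable_f])
  have "chirp_transform q \<phi> ((\<mu> + of_int k) / h) = of_real h * fourier k" for k
  proof -
    have "chirp_transform q \<phi> ((\<mu> + of_int k) / h) = 
       \<bar>h\<bar> *\<^sub>R (LINT x|lborel. cis (pi * q * (0 + h * x)\<^sup>2 - 2 * pi * ((\<mu> + of_int k) / h) * (0 + h * x)) * \<phi> (0 + h * x))"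
      unfolding chirp_transform_def by (rule lborel_integral_real_affine) (use h in simp)
    also have "(LINT x|lborel. cis (pi * q * (0 + h * x)\<^sup>2 - 2 * pi * ((\<mu> + of_int k) / h) * (0 + h * x)) * \<phi> (0 + h * x)) = fourier k"
      unfolding fourier_def
    proof (rule Bochner_Integration.integral_cong[OF refl])
      fix x
      have "pi * q * (0 + h * x)\<^sup>2 - 2 * pi * ((\<mu> + of_int k) / h) * (0 + h * x) =
          (pi * q * h\<^sup>2 * x\<^sup>2 + (- 2 * pi * \<mu>) * x) + (- 2 * pi * of_int k * x)"
        using h by (simp add: field_simps power2_eq_square)
      then show "cis (pi * q * (0 + h * x)\<^sup>2 - 2 * pi * ((\<mu> + of_int k) / h) * (0 + h * x)) * \<phi> (0 + h * x) =
         f x * cis (- 2 * pi * of_int k * x)"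
        by (simp only: f_def cis_mult[symmetric]) (simp add: mult_ac)
    qed
    finally show ?thesis using h by (simp add: scaleR_conv_of_real)
  qed
  then show "((\<lambda>k::int. chirp_transform q \<phi> ((\<mu> + of_int k) / h)) has_sum of_real h * infsum g UNIV) UNIV"
    using has_sum_cmult_right[OF poisson_summation, of "of_real h"] unfolding g by simp
qed

lemma has_sum_sum:
  fixes f :: "'i \<Rightarrow> 'a \<Rightarrow> complex"
  assumes "finite I" "\<And>i. i \<in> I \<Longrightarrow> (f i has_sum s i) A"
  shows "((\<lambda>x. \<Sum>i\<in>I. f i x) has_sum (\<Sum>i\<in>I. s i)) A"
  using assms by (induction I rule: finite_induct) (auto intro: has_sum_add)

lemma has_sum_residue_classes:
  fixes f :: "int \<Rightarrow> complex"
  assumes "L > 0" "\<And>r. r < L \<Longrightarrow> ((\<lambda>m. f (int r + int L * m)) has_sum s r) UNIV"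
  shows "(f has_sum (\<Sum>r<L. s r)) UNIV"
proof -
  have "(f has_sum (\<Sum>r<L. s r)) (\<Union>r\<in>{..<L}. range (\<lambda>m. int r + int L * m))"
  proof (rule sum_has_sum)
    fix r assume "r \<in> {..<L}"
    moreover have "inj (\<lambda>m. int r + int L * m)" using assms(1) by (auto simp: inj_on_def)
    ultimately show "(f has_sum s r) (range (\<lambda>m. int r + int L * m))"
      using assms(2)[of r] by (simp add: has_sum_reindex o_def)
  next
    fix r r' assume *: "r \<in> {..<L}" "r' \<in> {..<L}" "r \<noteq> r'"
    have "(int r + int L * m) mod int L = int r" if "r < L" for r m using that by simp
    then show "range (\<lambda>m. int r + int L * m) \<inter> range (\<lambda>m. int r' + int L * m) = {}"
      using * by (auto; metis lessThan_iff of_nat_eq_iff)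
  qed simp
  moreover have "(\<Union>r\<in>{..<L}. range (\<lambda>m. int r + int L * m)) = UNIV"
  proof -
    have "k \<in> (\<Union>r\<in>{..<L}. range (\<lambda>m. int r + int L * m))" for k
    proof (rule UN_I)
      show "nat (k mod int L) \<in> {..<L}" using assms(1) by (simp add: nat_less_iff)
      show "k \<in> range (\<lambda>m. int (nat (k mod int L)) + int L * m)"
        using assms(1) by (intro image_eqI[of _ _ "k div int L"]) simp_all
    qed
    then show ?thesis by blast
  qed
  ultimately show ?thesis by simp
qed

text \<open>
  The quadratic Gauss sum that results from collecting the residue classes modulo \<open>2b\<close>.  The period is
  \<open>2b\<close> and not \<open>b\<close> because the exponent carries \<open>\<pi>\<close> in place of \<open>2\<pi>\<close>.
\<close>
definition gauss_sum :: "nat \<Rightarrow> int \<Rightarrow> int \<Rightarrow> complex" where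
  "gauss_sum b p n = (\<Sum>r<2*b. cis (pi * (of_int p * (real r)\<^sup>2 - real r * of_int n) / real b))"

definition comb_weight :: "nat \<Rightarrow> int \<Rightarrow> real \<Rightarrow> int \<Rightarrow> complex" where
  "comb_weight b p s n = of_real (s / (2 * real b)) / csqrt (\<i> * of_real s) * gauss_sum b p n *
     cis (pi * (of_int p / real b) * (s / (2 * real b) * of_int n)\<^sup>2)"

text \<open>
  In the class of \<open>r\<close> modulo \<open>2b\<close> the outer chirp has the constant value belonging to \<open>r\<close>, and Poisson
  summation applies to the rest; exchanging the finite sum over \<open>r\<close> with the sum over the lattice
  produces the Gauss sum.
\<close>
lemma frft_comb_has_sum:
  assumes \<phi>: "schwartz \<phi>" and b: "b > 0" and s: "sin (pi * \<alpha> / 2) = s" "s > 0"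
    and c: "cos (pi * \<alpha> / 2) = of_int p / real b * s"
  shows "((\<lambda>n. comb_weight b p s n * \<phi> (s / (2 * real b) * of_int n)) has_sum frft_distr \<alpha> dirac_comb \<phi>) UNIV"
proof -
  define q where "q = of_int p / real b"
  define h where "h = s / (2 * real b)"
  define K where "K = 1 / csqrt (\<i> * of_real s)"
  define g where "g = (\<lambda>r::nat. \<lambda>n::int. cis (pi * q * (h * of_int n)\<^sup>2 - 2 * pi * (real r / (2 * real b)) * of_int n) * \<phi> (h * of_int n))"
  define S where "S = (\<lambda>r::nat. of_real h * K * cis (pi * q * (real r)\<^sup>2) * infsum (g r) UNIV)"
  have h: "h > 0" using s b by (simp add: h_def)
  have "((\<lambda>m. frft \<alpha> \<phi> (of_int (int r + int (2 * b) * m))) has_sum S r) UNIV" for r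
  proof -
    have "frft \<alpha> \<phi> (of_int (int r + int (2 * b) * m)) = 
       (K * cis (pi * q * (real r)\<^sup>2)) * chirp_transform q \<phi> ((real r / (2 * real b) + of_int m) / h)" for m
    proof -
      define k where "k = int r + int (2 * b) * m"
      have kr: "real_of_int k = real r + 2 * real b * of_int m" by (simp add: k_def)
      have 1: "real_of_int k / s = (real r / (2 * real b) + of_int m) / h"
        using b s by (simp add: kr h_def field_simps)
      have "pi * q * (of_int k)\<^sup>2 = pi * q * (real r)\<^sup>2 + 2 * pi * of_int (p * (2 * int r * m + 2 * int b * m\<^sup>2))"
        using b by (simp add: kr q_def field_simps power2_eq_square)
      then have 2: "cis (pi * q * (of_int k)\<^sup>2) = cis (pi * q * (real r)\<^sup>2)"
        by (simp only: cis_mult[symmetric] cis_multiple_2pi Ints_of_int mult_1_right)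
      show ?thesis
        using frft_eq_chirp_transform[OF s(1) _ c, of \<phi> "of_int k"] s(2)
        unfolding k_def[symmetric] by (simp only: 1 2 q_def[symmetric] K_def)
    qed
    then show ?thesis
      using has_sum_cmult_right[OF poisson_chirp_transform(2)[OF \<phi> h, of q "real r / (2 * real b)"], of "K * cis (pi * q * (real r)\<^sup>2)"]
      by (simp add: S_def g_def mult_ac)
  qed
  then have "((\<lambda>k. frft \<alpha> \<phi> (of_int k)) has_sum (\<Sum>r<2*b. S r)) UNIV"
    by (intro has_sum_residue_classes) (use b in auto)
  then have T: "frft_distr \<alpha> dirac_comb \<phi> = (\<Sum>r<2*b. S r)"
    by (simp add: frft_distr_def dirac_comb_def infsumI)
  have "((\<lambda>n. \<Sum>r<2*b. (of_real h * K * cis (pi * q * (real r)\<^sup>2)) * g r n) has_sum (\<Sum>r<2*b. S r)) UNIV"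
    unfolding S_def g_def
    by (intro has_sum_sum has_sum_cmult_right poisson_chirp_transform(1)[OF \<phi> h]) auto
  moreover have "(\<Sum>r<2*b. (of_real h * K * cis (pi * q * (real r)\<^sup>2)) * g r n) = comb_weight b p s n * \<phi> (h * of_int n)" for n
  proof -
    have "(of_real h * K * cis (pi * q * (real r)\<^sup>2)) * g r n = of_real h * K *
        cis (pi * (of_int p * (real r)\<^sup>2 - real r * of_int n) / real b) * cis (pi * q * (h * of_int n)\<^sup>2) * \<phi> (h * of_int n)" for r
    proof -
      have "pi * q * (real r)\<^sup>2 + (pi * q * (h * of_int n)\<^sup>2 - 2 * pi * (real r / (2 * real b)) * of_int n)
        = pi * (of_int p * (real r)\<^sup>2 - real r * of_int n) / real b + pi * q * (h * of_int n)\<^sup>2"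
        using b by (simp add: q_def field_simps)
      then have "cis (pi * q * (real r)\<^sup>2) * cis (pi * q * (h * of_int n)\<^sup>2 - 2 * pi * (real r / (2 * real b)) * of_int n)
        = cis (pi * (of_int p * (real r)\<^sup>2 - real r * of_int n) / real b) * cis (pi * q * (h * of_int n)\<^sup>2)"
        by (simp only: cis_mult)
      then show ?thesis unfolding g_def by (simp add: mult.assoc[symmetric])
    qed
    then have "(\<Sum>r<2*b. (of_real h * K * cis (pi * q * (real r)\<^sup>2)) * g r n) = 
      (\<Sum>r<2*b. of_real h * K * cis (pi * (of_int p * (real r)\<^sup>2 - real r * of_int n) / real b) * cis (pi * q * (h * of_int n)\<^sup>2) * \<phi> (h * of_int n))"
      by (simp only:)
    also have "\<dots> = of_real h * K * gauss_sum b p n * cis (pi * q * (h * of_int n)\<^sup>2) * \<phi> (h * of_int n)"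
      by (simp only: gauss_sum_def sum_distrib_left sum_distrib_right)
    finally show ?thesis by (simp add: comb_weight_def h_def K_def q_def)
  qed
  ultimately show ?thesis unfolding T by (simp only: h_def)
qed

lemma divide_in_Ints_iff:
  fixes h x :: real
  assumes "h > 0"
  shows "x / h \<in> \<int> \<longleftrightarrow> x \<in> range (\<lambda>n::int. h * of_int n)"
proof
  assume "x / h \<in> \<int>"
  then obtain n where "x / h = of_int n" by (auto elim: Ints_cases)
  then have "x = h * of_int n" using assms by (simp add: field_simps)
  then show "x \<in> range (\<lambda>n::int. h * of_int n)" by blast
qed (use assms in auto)

lemma is_delta_series_lattice:
  assumes h: "h > 0" and W: "\<And>\<phi>. schwartz \<phi> \<Longrightarrow> ((\<lambda>n::int. W n * \<phi> (h * of_int n)) has_sum T \<phi>) UNIV"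
  shows "is_delta_series T (\<lambda>x. if x / h \<in> \<int> then W \<lfloor>x / h\<rfloor> else 0)"
  unfolding is_delta_series_def
proof (intro conjI allI impI)
  fix R
  have "{x \<in> {-R..R}. (if x / h \<in> \<int> then W \<lfloor>x / h\<rfloor> else 0) \<noteq> 0} \<subseteq> (\<lambda>n. h * of_int n) ` {\<lfloor>- R / h\<rfloor>..\<lceil>R / h\<rceil>}"
  proof
    fix x assume "x \<in> {x \<in> {-R..R}. (if x / h \<in> \<int> then W \<lfloor>x / h\<rfloor> else 0) \<noteq> 0}"
    then have x: "- R \<le> x" "x \<le> R" "x / h \<in> \<int>" by (auto split: if_splits)
    then obtain n where n: "x / h = of_int n" by (auto elim: Ints_cases)
    have "- R / h \<le> x / h" "x / h \<le> R / h" using divide_right_mono[OF x(1), of h] divide_right_mono[OF x(2), of h] h by simp_all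
    then have "n \<in> {\<lfloor>- R / h\<rfloor>..\<lceil>R / h\<rceil>}" unfolding n by (simp add: floor_le_iff le_ceiling_iff)
    then show "x \<in> (\<lambda>n. h * of_int n) ` {\<lfloor>- R / h\<rfloor>..\<lceil>R / h\<rceil>}"
      using n h by (intro image_eqI[of _ _ n]) (simp_all add: field_simps)
  qed
  then show "finite {x \<in> {-R..R}. (if x / h \<in> \<int> then W \<lfloor>x / h\<rfloor> else 0) \<noteq> 0}"
    by (rule finite_subset) simp
next
  fix \<phi> assume "schwartz \<phi>"
  let ?w = "\<lambda>x. if x / h \<in> \<int> then W \<lfloor>x / h\<rfloor> else 0"
  have "inj (\<lambda>n::int. h * of_int n)" using h by (auto simp: inj_on_def)
  then have "((\<lambda>x. ?w x * \<phi> x) has_sum T \<phi>) (range (\<lambda>n::int. h * of_int n))"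
    using W[OF \<open>schwartz \<phi>\<close>] h by (simp add: has_sum_reindex o_def)
  moreover have "?w x * \<phi> x = 0" if "x \<notin> range (\<lambda>n::int. h * of_int n)" for x
    using that divide_in_Ints_iff[OF h, of x] by simp
  ultimately show "((\<lambda>x. ?w x * \<phi> x) has_sum T \<phi>) UNIV"
    by (subst has_sum_cong_neutral[where T = "range (\<lambda>n::int. h * of_int n)" and g = "\<lambda>x. ?w x * \<phi> x"]) auto
qed

lemma delta_mass_lattice:
  assumes h: "h > 0" and W: "\<And>\<phi>. schwartz \<phi> \<Longrightarrow> ((\<lambda>n::int. W n * \<phi> (h * of_int n)) has_sum T \<phi>) UNIV"
    and fin: "finite {n::int. h * of_int n \<in> A}"
  shows "delta_mass T A = (\<Sum>n | h * of_int n \<in> A. W n)"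
proof -
  let ?w = "\<lambda>x. if x / h \<in> \<int> then W \<lfloor>x / h\<rfloor> else 0"
  let ?B = "(\<lambda>n::int. h * of_int n) ` {n. h * of_int n \<in> A}"
  have "delta_mass T A = infsum ?w A"
    unfolding delta_mass_def using delta_weight_eq[OF is_delta_series_lattice[OF h W]] by simp
  also have "\<dots> = infsum ?w ?B"
  proof (rule infsum_cong_neutral)
    fix x assume x: "x \<in> A - ?B"
    have "x / h \<notin> \<int>" using x divide_in_Ints_iff[OF h, of x] by auto
    then show "?w x = 0" by simp
  qed auto
  also have "\<dots> = sum ?w ?B" using fin by simp
  also have "\<dots> = (\<Sum>n | h * of_int n \<in> A. W n)"
    using h by (subst sum.reindex) (auto simp: inj_on_def)
  finally show ?thesis .
qed

section \<open>Quadratic exponential sums and Fresnel integrals\<close>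

lemma norm_cis_diff_1: "norm (cis t - 1) \<le> \<bar>t\<bar>"
  using dist_exp_i_1[of t] abs_sin_x_le_abs_x[of "t/2"] by (simp add: cis_conv_exp)

lemma norm_diff_le_vector_derivative:
  fixes f :: "real \<Rightarrow> 'a::real_normed_vector"
  assumes "\<And>x. (f has_vector_derivative f' x) (at x)"
    and "\<And>x. x \<in> closed_segment a b \<Longrightarrow> norm (f' x) \<le> B"
  shows "norm (f b - f a) \<le> B * \<bar>b - a\<bar>"
proof -
  have "norm (f b - f a) \<le> B * norm (b - a)"
  proof (rule differentiable_bound[OF convex_closed_segment, of a b f "\<lambda>x h. h *\<^sub>R f' x"])
    fix x assume x: "x \<in> closed_segment a b"
    show "(f has_derivative (\<lambda>h. h *\<^sub>R f' x)) (at x within closed_segment a b)"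
      using assms(1)[of x] has_derivative_at_withinI by (auto simp: has_vector_derivative_def)
    show "onorm (\<lambda>h. h *\<^sub>R f' x) \<le> B"
      using assms(2)[OF x] by (intro onorm_le) (simp add: mult.commute[of B] mult_left_mono)
  qed auto
  then show ?thesis by simp
qed

lemma fresnel_has_vector_derivative: "(fresnel has_vector_derivative cis (pi * x\<^sup>2)) (at x)"
proof -
  let ?f = "\<lambda>x::real. exp (of_real pi * \<i> * of_real (x\<^sup>2))"
  define r where "r = \<bar>x\<bar> + 1"
  have "((\<lambda>u. LBINT y=ereal 0..ereal u. ?f y) has_vector_derivative ?f x) (at x within {- r..r})"
    by (rule interval_integral_FTC2) (auto simp: r_def intro!: continuous_intros)
  moreover have "at x within {- r..r} = at x"
    by (intro at_within_interior) (auto simp: r_def)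
  ultimately show ?thesis
    unfolding fresnel_def[abs_def] by (simp add: cis_conv_exp mult_ac)
qed

lemma fresnel_0: "fresnel 0 = 0"
  by (simp add: fresnel_def)

text \<open>
  The factor is the inverse of \<open>cis d - 1\<close>.  It turns each term of an exponential sum into a multiple of
  the difference between the next term and itself.
\<close>
lemma cis_minus_1_mult_cot:
  assumes "sin (d / 2) \<noteq> 0"
  shows "(cis d - 1) * (- 1 / 2 - \<i> / 2 * of_real (cot (d / 2))) = 1"
proof -
  define y where "y = d / 2"
  have d: "d = 2 * y" by (simp add: y_def)
  have s: "sin y \<noteq> 0" using assms by (simp add: y_def)
  have 1: "cis d - 1 = 2 * \<i> * of_real (sin y) * cis y"
    unfolding d complex_eq_iff by (simp add: cos_double_sin sin_double power2_eq_square)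
  have 2: "- 1 / 2 - \<i> / 2 * of_real (cot y) = - (\<i> / 2) * cis (- y) / of_real (sin y)"
    unfolding complex_eq_iff using s by (simp add: cot_def)
  have "(cis d - 1) * (- 1 / 2 - \<i> / 2 * of_real (cot y)) = cis y * cis (- y)"
    unfolding 1 2 using s by (simp add: field_simps)
  then have "(cis d - 1) * (- 1 / 2 - \<i> / 2 * of_real (cot y)) = 1" by (simp add: cis_mult)
  then show ?thesis by (simp add: y_def)
qed

text \<open>
  The cotangent without its pole at \<open>0\<close>.
\<close>
definition cot_reg :: "real \<Rightarrow> real" where "cot_reg y = cot y - 1 / y"

lemma cot_reg_antimono:
  assumes "0 < x" "x \<le> y" "y < pi"
  shows "cot_reg y \<le> cot_reg x"
proof (rule DERIV_nonpos_imp_nonincreasing[OF assms(2)])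
  fix t assume t: "x \<le> t" "t \<le> y"
  have t0: "0 < t" and s: "0 < sin t" using t assms by (auto intro!: sin_gt_zero)
  have "(sin t)\<^sup>2 \<le> t\<^sup>2" using t0 s sin_x_le_x[of t] by (intro power_mono) auto
  then have "inverse (t\<^sup>2) \<le> inverse ((sin t)\<^sup>2)" using s by (intro le_imp_inverse_le) auto
  moreover have "(cot_reg has_real_derivative - inverse ((sin t)\<^sup>2) + inverse (t\<^sup>2)) (at t)"
  proof -
    have "((\<lambda>t. 1 / t) has_real_derivative - inverse (t\<^sup>2)) (at t)"
      using t0 by (auto intro!: derivative_eq_intros simp: power2_eq_square divide_inverse)
    then show ?thesis
      unfolding cot_reg_def[abs_def] using DERIV_diff[OF DERIV_cot] s by force
  qed
  ultimately show "\<exists>D. (cot_reg has_real_derivative D) (at t) \<and> D \<le> 0"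
    by (intro exI[of _ "- inverse ((sin t)\<^sup>2) + inverse (t\<^sup>2)"]) auto
qed

lemma cot_reg_bounds:
  assumes y: "0 < y" "y \<le> 1/2"
  shows "-1 \<le> cot_reg y" "cot_reg y \<le> 0"
proof -
  have s: "0 < sin y" and c: "0 < cos y"
    using y pi_gt3 by (auto intro!: sin_gt_zero cos_gt_zero)
  have sy: "sin y \<le> y" using y by (intro sin_x_le_x) auto
  have "1 \<le> sin y + cos y"
  proof -
    have "(sin y)\<^sup>2 + (cos y)\<^sup>2 \<le> sin y + cos y"
      unfolding power2_eq_square using s c by (intro add_mono) (simp_all add: mult_left_le_one_le)
    then show ?thesis by simp
  qed
  then have "y * 1 \<le> y * (sin y + cos y)" using y by (intro mult_left_mono) auto
  with sy have "sin y \<le> y * cos y + y * sin y" by (simp add: distrib_left)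
  then show "-1 \<le> cot_reg y"
    using s y by (simp add: cot_reg_def cot_def field_simps)
  have "y \<le> tan y"
  proof -
    have "arctan (tan y) = y" using y pi_gt3 by (intro arctan_tan) auto
    moreover have "tan y > 0" using y pi_gt3 by (intro tan_gt_zero) auto
    ultimately show ?thesis using arctan_le_self[of "tan y"] by simp
  qed
  then show "cot_reg y \<le> 0"
    using s c y by (simp add: cot_reg_def cot_def tan_def field_simps)
qed

text \<open>
  Summation by parts: as \<open>g\<close> is monotone, its total variation is the difference of its end values.
\<close>
lemma abel_summation_bound:
  fixes E :: "nat \<Rightarrow> complex" and g :: "nat \<Rightarrow> real"
  assumes "\<And>m. norm (E m) \<le> 1" and "\<And>m. m < M \<Longrightarrow> g (Suc m) \<le> g m"
  shows "norm ((\<Sum>m<M. (E (Suc m) - E m) * of_real (g m)) - E M * of_real (g M)) \<le> \<bar>g 0\<bar> + (g 0 - g M)"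
  using assms(2)
proof (induction M)
  case 0
  show ?case using assms(1)[of 0] by (simp add: norm_mult mult_left_le_one_le)
next
  case (Suc M)
  let ?S = "\<lambda>M. (\<Sum>m<M. (E (Suc m) - E m) * of_real (g m)) - E M * of_real (g M)"
  have "?S (Suc M) = ?S M + E (Suc M) * of_real (g M - g (Suc M))"
    by (simp add: algebra_simps)
  then have "norm (?S (Suc M)) \<le> norm (?S M) + norm (E (Suc M) * of_real (g M - g (Suc M)))"
    by (simp only: norm_triangle_ineq)
  also have "norm (E (Suc M) * of_real (g M - g (Suc M))) \<le> 1 * (g M - g (Suc M))"
    using assms(1)[of "Suc M"] Suc.prems[of M] unfolding norm_mult norm_of_real by (intro mult_mono) auto
  finally show ?case using Suc by simp
qed

text \<open>
  On a unit interval the quadratic phase differs from the linear one with the same end values by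
  \<open>\<kappa>(u\<^sup>2 - u)\<close>, and the integral of the linear one is explicit.
\<close>
lemma quadratic_exponential_interval:
  assumes F: "\<And>t. (F has_vector_derivative cis (\<kappa> * t\<^sup>2)) (at t)"
    and "\<kappa> > 0" "c \<ge> 0" and d: "d = \<kappa> * (2 * c + 1)"
  shows "norm (F (c + 1) - F c - (cis (\<kappa> * (c + 1)\<^sup>2) - cis (\<kappa> * c\<^sup>2)) * (1 / (\<i> * of_real d))) \<le> \<kappa>"
proof -
  have d0: "d \<noteq> 0" using assms by simp
  define H where "H = (\<lambda>u. F (c + u) - cis (\<kappa> * c\<^sup>2) * cis (d * u) * (1 / (\<i> * of_real d)))"
  define H' where "H' = (\<lambda>u. cis (\<kappa> * (c + u)\<^sup>2) - cis (\<kappa> * c\<^sup>2) * cis (d * u))"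
  have "(H has_vector_derivative H' u) (at u)" for u
  proof -
    have "((\<lambda>u. F (c + u)) has_vector_derivative 1 *\<^sub>R cis (\<kappa> * (c + u)\<^sup>2)) (at u)"
    proof -
      have "((\<lambda>u. c + u) has_vector_derivative 1) (at u)"
        unfolding has_real_derivative_iff_has_vector_derivative[symmetric]
        by (auto intro!: derivative_eq_intros)
      from vector_diff_chain_at[OF this F] show ?thesis by (simp add: o_def)
    qed
    moreover have "((\<lambda>u. cis (d * u)) has_vector_derivative d *\<^sub>R (\<i> * cis (d * u))) (at u)"
      using has_vector_derivative_cis[OF DERIV_cmult_Id, of d u] by (simp add: scaleR_conv_of_real)
    ultimately have "(H has_vector_derivative 1 *\<^sub>R cis (\<kappa> * (c + u)\<^sup>2) - 
        cis (\<kappa> * c\<^sup>2) * (d *\<^sub>R (\<i> * cis (d * u))) * (1 / (\<i> * of_real d))) (at u)"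
      unfolding H_def
      by (intro has_vector_derivative_diff has_vector_derivative_mult_left has_vector_derivative_mult_right)
    moreover have "\<i> * (z * (\<i> * w)) = - (z * w)" for z w
      by (simp add: mult.left_commute[of z \<i> w])
    ultimately show ?thesis using d0 by (simp add: H'_def scaleR_conv_of_real)
  qed
  moreover have "norm (H' u) \<le> \<kappa>" if "u \<in> closed_segment 0 1" for u
  proof -
    have u: "0 \<le> u" "u \<le> 1" using that by (auto simp: closed_segment_eq_real_ivl)
    have "H' u = cis (\<kappa> * c\<^sup>2) * cis (d * u) * (cis (\<kappa> * (u\<^sup>2 - u)) - 1)"
      unfolding H'_def d right_diff_distrib cis_mult by (simp add: power2_eq_square algebra_simps)
    then have "norm (H' u) = norm (cis (\<kappa> * (u\<^sup>2 - u)) - 1)" by (simp add: norm_mult)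
    also have "\<dots> \<le> \<bar>\<kappa> * (u\<^sup>2 - u)\<bar>" by (rule norm_cis_diff_1)
    also have "\<dots> = \<kappa> * (u * (1 - u))"
    proof -
      have "\<kappa> * (u\<^sup>2 - u) = - (\<kappa> * (u * (1 - u)))" by (simp add: power2_eq_square algebra_simps)
      then show ?thesis using u \<open>\<kappa> > 0\<close> by simp
    qed
    also have "\<dots> \<le> \<kappa> * (1 * 1)" using u \<open>\<kappa> > 0\<close> by (intro mult_left_mono mult_mono) auto
    finally show ?thesis by simp
  qed
  ultimately have "norm (H 1 - H 0) \<le> \<kappa> * \<bar>1 - 0\<bar>" by (rule norm_diff_le_vector_derivative)
  moreover have "cis (\<kappa> * c\<^sup>2) * cis d = cis (\<kappa> * (c + 1)\<^sup>2)"
    unfolding cis_mult d by (simp add: power2_eq_square algebra_simps)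
  then have "H 1 - H 0 = F (c + 1) - F c - (cis (\<kappa> * (c + 1)\<^sup>2) - cis (\<kappa> * c\<^sup>2)) * (1 / (\<i> * of_real d))"
    by (simp add: H_def algebra_simps)
  ultimately show ?thesis by simp
qed

text \<open>
  Sum and integral are both written through the differences of consecutive terms, with coefficients
  \<open>1 / (cis d - 1)\<close> and \<open>1 / (\<i>d)\<close> for the phase increment \<open>d\<close>.  The poles at \<open>d = 0\<close> cancel, and the
  difference \<open>- 1/2 - \<i>/2 cot_reg (d/2)\<close> is bounded and has a monotone second part, so summation by
  parts gives a bound that does not depend on the number of terms.  The linearisation costs at most
  \<open>\<kappa>\<close> per interval, and \<open>\<kappa>M \<le> 1/2\<close>.
\<close>
lemma quadratic_exponential_sum_lessThan:
  assumes F: "\<And>t. (F has_vector_derivative cis (\<kappa> * t\<^sup>2)) (at t)"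
    and \<kappa>: "\<kappa> > 0" and \<rho>: "\<rho> \<ge> 0" and M: "\<kappa> * (2 * (real M + \<rho>) + 1) \<le> 1"
  shows "norm ((\<Sum>m<M. cis (\<kappa> * (real m + \<rho>)\<^sup>2)) - (F (real M + \<rho>) - F \<rho>)) \<le> 3"
proof -
  define E where "E = (\<lambda>m::nat. cis (\<kappa> * (real m + \<rho>)\<^sup>2))"
  define d where "d = (\<lambda>m::nat. \<kappa> * (2 * (real m + \<rho>) + 1))"
  define g where "g = (\<lambda>m. cot_reg (d m / 2))"
  \<comment> \<open>\<open>r\<close> is the linearisation error, \<open>g\<close> the regular part of the coefficient\<close>
  define r where "r = (\<lambda>m. F (real (Suc m) + \<rho>) - F (real m + \<rho>) - (E (Suc m) - E m) * (1 / (\<i> * of_real (d m))))"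
  have d0: "d m > 0" for m using \<kappa> \<rho> by (auto simp: d_def)
  have d1: "d m \<le> 1" if "m \<le> M" for m
  proof -
    have "d m \<le> d M" unfolding d_def using that \<kappa> by (intro mult_left_mono) auto
    then show ?thesis using M by (simp add: d_def)
  qed
  have r: "norm (r m) \<le> \<kappa>" for m
    using quadratic_exponential_interval[OF F \<kappa>, of "real m + \<rho>" "d m"] \<rho>
    by (simp add: r_def E_def d_def add_ac)
  have E_step: "E m = (E (Suc m) - E m) * (- 1 / 2 - \<i> / 2 * of_real (cot (d m / 2)))" if "m < M" for m
  proof -
    have "sin (d m / 2) > 0" using d0[of m] d1[of m] that pi_gt3 by (intro sin_gt_zero) auto
    then have 1: "(cis (d m) - 1) * (- 1 / 2 - \<i> / 2 * of_real (cot (d m / 2))) = 1"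
      by (intro cis_minus_1_mult_cot) auto
    have 2: "E (Suc m) = E m * cis (d m)"
      unfolding E_def d_def cis_mult by (simp add: power2_eq_square algebra_simps)
    have "E (Suc m) - E m = E m * (cis (d m) - 1)" unfolding 2 by (simp add: algebra_simps)
    then show ?thesis using 1 by (simp only: mult.assoc mult_1_right)
  qed
  have step: "E m - (F (real (Suc m) + \<rho>) - F (real m + \<rho>)) =
      - 1 / 2 * (E (Suc m) - E m) - \<i> / 2 * ((E (Suc m) - E m) * of_real (g m)) - r m" if "m < M" for m
  proof -
    have "- 1 / 2 - \<i> / 2 * of_real (cot (d m / 2)) - 1 / (\<i> * of_real (d m)) =
       - 1 / 2 - \<i> / 2 * of_real (g m)"
      by (simp add: g_def cot_reg_def complex_eq_iff Re_divide Im_divide power2_eq_square)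
         (simp add: field_simps)
    then have "(E (Suc m) - E m) * (- 1 / 2 - \<i> / 2 * of_real (cot (d m / 2))) - (E (Suc m) - E m) * (1 / (\<i> * of_real (d m)))
       = (E (Suc m) - E m) * (- 1 / 2 - \<i> / 2 * of_real (g m))"
      by (metis right_diff_distrib)
    then have "E m = (E (Suc m) - E m) * (1 / (\<i> * of_real (d m))) + (E (Suc m) - E m) * (- 1 / 2 - \<i> / 2 * of_real (g m))"
      by (simp only: E_step[OF that, symmetric] diff_eq_eq add.commute)
    moreover have "e - F = - 1 / 2 * D - \<i> / 2 * (D * G) - (F - D * Q)"
      if "e = D * Q + D * (- 1 / 2 - \<i> / 2 * G)" for e D F G Q :: complex
      using that by (simp add: algebra_simps)
    ultimately show ?thesis unfolding r_def by blast
  qed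
  define T where "T = (\<Sum>m<M. (E (Suc m) - E m) * of_real (g m))"
  have "(\<Sum>m<M. E m) - (F (real M + \<rho>) - F \<rho>) =
     (\<Sum>m<M. E m - (F (real (Suc m) + \<rho>) - F (real m + \<rho>)))"
    using sum_lessThan_telescope[of "\<lambda>m. F (real m + \<rho>)" M] by (simp add: sum_subtractf)
  also have "\<dots> = (\<Sum>m<M. - 1 / 2 * (E (Suc m) - E m) - \<i> / 2 * ((E (Suc m) - E m) * of_real (g m)) - r m)"
    by (intro sum.cong refl step) auto
  also have "\<dots> = - 1 / 2 * (E M - E 0) - \<i> / 2 * T - (\<Sum>m<M. r m)"
  proof -
    have "(\<Sum>m<M. - 1 / 2 * (E (Suc m) - E m)) = - 1 / 2 * (E M - E 0)"
      by (simp only: sum_distrib_left[symmetric] sum_lessThan_telescope)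
    moreover have "(\<Sum>m<M. \<i> / 2 * ((E (Suc m) - E m) * of_real (g m))) = \<i> / 2 * T"
      by (simp only: sum_distrib_left T_def)
    ultimately show ?thesis by (simp only: sum_subtractf)
  qed
  also have "norm \<dots> \<le> norm (- 1 / 2 * (E M - E 0)) + norm (\<i> / 2 * T) + norm (\<Sum>m<M. r m)"
    by (intro order_trans[OF norm_triangle_ineq4] add_right_mono norm_triangle_ineq4)
  also have "norm (- 1 / 2 * (E M - E 0)) \<le> 1"
  proof -
    have "norm (E M - E 0) \<le> norm (E M) + norm (E 0)" by (rule norm_triangle_ineq4)
    then show ?thesis by (simp add: norm_mult E_def norm_divide)
  qed
  also have "norm (\<i> / 2 * T) \<le> 3 / 2"
  proof -
    have anti: "g (Suc m) \<le> g m" if "m < M" for m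
      unfolding g_def
    proof (rule cot_reg_antimono)
      show "d (Suc m) / 2 < pi" using d1[of "Suc m"] that pi_gt3 by auto
      show "d m / 2 \<le> d (Suc m) / 2" using \<kappa> unfolding d_def by (intro divide_right_mono mult_left_mono) auto
    qed (use d0 in simp)
    have "norm (T - E M * of_real (g M)) \<le> \<bar>g 0\<bar> + (g 0 - g M)"
      unfolding T_def by (rule abel_summation_bound) (simp_all add: E_def anti)
    moreover have "norm T \<le> norm (T - E M * of_real (g M)) + norm (E M * of_real (g M))"
      using norm_triangle_sub[of T "E M * of_real (g M)"] by simp
    moreover have "norm (E M * of_real (g M)) = \<bar>g M\<bar>" by (simp add: norm_mult E_def)
    moreover have "-1 \<le> g m" "g m \<le> 0" if "m \<le> M" for m
      using cot_reg_bounds[of "d m / 2"] d0[of m] d1[OF that] by (auto simp: g_def)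
    from this[of 0] this[of M] have "-1 \<le> g 0" "g 0 \<le> 0" "-1 \<le> g M" "g M \<le> 0" by auto
    ultimately have "norm T \<le> 3" by linarith
    then show ?thesis by (simp add: norm_mult norm_divide)
  qed
  also have "norm (\<Sum>m<M. r m) \<le> 1 / 2"
  proof -
    have "norm (\<Sum>m<M. r m) \<le> (\<Sum>m<M. \<kappa>)" by (rule sum_norm_le) (rule r)
    also have "\<dots> = \<kappa> * real M" by simp
    also have "\<dots> \<le> \<kappa> * ((2 * (real M + \<rho>) + 1) / 2)" using \<kappa> \<rho> by (intro mult_left_mono) auto
    also have "\<dots> \<le> 1 / 2" using M by simp
    finally show ?thesis .
  qed
  finally show ?thesis by (simp add: E_def)
qed

text \<open>
  The number of terms \<open>M\<close> satisfies \<open>\<bar>M + \<rho> - Y\<bar> \<le> 1\<close>, so that adjusting the two end points of the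
  integral costs at most \<open>2\<close>.
\<close>
lemma quadratic_exponential_sum:
  assumes F: "\<And>t. (F has_vector_derivative cis (\<kappa> * t\<^sup>2)) (at t)"
    and \<kappa>: "\<kappa> > 0" and \<rho>: "0 \<le> \<rho>" "\<rho> \<le> 1" and Y: "0 \<le> Y" "\<kappa> * (2 * Y + 3) \<le> 1"
  shows "norm ((\<Sum>m | real m + \<rho> \<le> Y. cis (\<kappa> * (real m + \<rho>)\<^sup>2)) - (F Y - F 0)) \<le> 5"
proof -
  define M where "M = nat (\<lfloor>Y - \<rho>\<rfloor> + 1)"
  have set: "{m. real m + \<rho> \<le> Y} = {..<M}"
  proof (intro set_eqI)
    fix m :: nat
    have "real m + \<rho> \<le> Y \<longleftrightarrow> int m \<le> \<lfloor>Y - \<rho>\<rfloor>" by (simp add: le_floor_iff) linarith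
    also have "\<dots> \<longleftrightarrow> m < M" by (auto simp: M_def)
    finally show "m \<in> {m. real m + \<rho> \<le> Y} \<longleftrightarrow> m \<in> {..<M}" by simp
  qed
  have MY: "\<bar>real M + \<rho> - Y\<bar> \<le> 1"
  proof (cases "Y - \<rho> \<ge> 0")
    case True
    then have "real M = of_int \<lfloor>Y - \<rho>\<rfloor> + 1" by (simp add: M_def)
    then show ?thesis by linarith
  next
    case False
    then have "M = 0" by (simp add: M_def) linarith
    then show ?thesis using False \<rho> Y by simp
  qed
  have lip: "norm (F y - F x) \<le> \<bar>y - x\<bar>" for x y
    using norm_diff_le_vector_derivative[OF F, of x y 1] by simp
  have "\<kappa> * (2 * (real M + \<rho>) + 1) \<le> \<kappa> * (2 * Y + 3)"
    using MY \<kappa> by (intro mult_left_mono) (auto simp: abs_le_iff)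
  then have "norm ((\<Sum>m<M. cis (\<kappa> * (real m + \<rho>)\<^sup>2)) - (F (real M + \<rho>) - F \<rho>)) \<le> 3"
    using Y by (intro quadratic_exponential_sum_lessThan F \<kappa> \<rho>) auto
  moreover have "norm (F (real M + \<rho>) - F Y) \<le> 1" using lip[of "real M + \<rho>" Y] MY by linarith
  moreover have "norm (F \<rho> - F 0) \<le> 1" using lip[of \<rho> 0] \<rho> by simp
  moreover have "(\<Sum>m<M. cis (\<kappa> * (real m + \<rho>)\<^sup>2)) - (F Y - F 0) =
     ((\<Sum>m<M. cis (\<kappa> * (real m + \<rho>)\<^sup>2)) - (F (real M + \<rho>) - F \<rho>)) + (F (real M + \<rho>) - F Y) - (F \<rho> - F 0)"
    by simp
  ultimately show ?thesis unfolding set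
    by (smt (verit, best) norm_triangle_ineq norm_triangle_ineq4)
qed

section \<open>The antiderivative of the transformed comb\<close>

lemma gauss_sum_periodic:
  assumes "b > 0"
  shows "gauss_sum b p (n + 2 * int b * m) = gauss_sum b p n"
  unfolding gauss_sum_def
proof (rule sum.cong[OF refl])
  fix r
  have "pi * (of_int p * (real r)\<^sup>2 - real r * of_int (n + 2 * int b * m)) / real b =
     pi * (of_int p * (real r)\<^sup>2 - real r * of_int n) / real b + 2 * pi * of_int (- int r * m)"
    using assms by (simp add: field_simps)
  then show "cis (pi * (of_int p * (real r)\<^sup>2 - real r * of_int (n + 2 * int b * m)) / real b) = 
     cis (pi * (of_int p * (real r)\<^sup>2 - real r * of_int n) / real b)"
    by (simp only: cis_mult[symmetric] cis_multiple_2pi Ints_of_int mult_1_right)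
qed

lemma norm_gauss_sum_le: "norm (gauss_sum b p n) \<le> 2 * real b"
  using sum_norm_le[of "{..<2*b}" "\<lambda>r. cis (pi * (of_int p * (real r)\<^sup>2 - real r * of_int n) / real b)" "\<lambda>_. 1"]
  by (simp add: gauss_sum_def)

text \<open>
  Summing over \<open>n\<close> first leaves full geometric sums of roots of unity, of which only the one for
  \<open>r = 0\<close> survives.
\<close>
lemma sum_gauss_sum:
  assumes b: "b > 0"
  shows "(\<Sum>n<2*b. gauss_sum b p (int n)) = 2 * of_nat b"
proof -
  have inner: "(\<Sum>n<2*b. cis (- (pi * real r / real b)) ^ n) = (if r = 0 then 2 * of_nat b else 0)" if r: "r < 2 * b" for r
  proof (cases "r = 0")
    case False
    let ?z = "cis (- (pi * real r / real b))"
    have "?z \<noteq> 1"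
    proof
      assume "?z = 1"
      then have "cos (pi * real r / real b) = 1" by (simp add: complex_eq_iff)
      then obtain k :: int where k: "pi * real r / real b = of_int k * 2 * pi"
        using cos_one_2pi_int by blast
      then have "real r = of_int k * 2 * real b" using b by (simp add: field_simps)
      then have "real_of_int (int r) = real_of_int (k * (2 * int b))" by simp
      then have "int r = k * (2 * int b)" by (simp only: of_int_eq_iff)
      then have "int (2 * b) dvd int r" by simp
      then show False using r False by (auto simp only: of_nat_dvd_iff dest: dvd_imp_le)
    qed
    moreover have "?z ^ (2 * b) = 1"
    proof -
      have "real (2 * b) * - (pi * real r / real b) = 2 * pi * of_int (- int r)"
        using b by (simp add: field_simps)
      then have "?z ^ (2 * b) = cis (2 * pi * of_int (- int r))"
        by (simp only: Complex.DeMoivre)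
      then show ?thesis by (simp only: cis_multiple_2pi Ints_of_int)
    qed
    ultimately show ?thesis using False geometric_sum[of ?z "2*b"] by simp
  qed simp
  have "(\<Sum>n<2*b. gauss_sum b p (int n)) = (\<Sum>r<2*b. \<Sum>n<2*b. cis (pi * of_int p * (real r)\<^sup>2 / real b) * cis (- (pi * real r / real b)) ^ n)"
    unfolding gauss_sum_def
  proof (subst sum.swap, intro sum.cong refl)
    fix r n :: nat
    have "pi * (of_int p * (real r)\<^sup>2 - real r * of_int (int n)) / real b = pi * of_int p * (real r)\<^sup>2 / real b + real n * (- (pi * real r / real b))"
      using b by (simp add: field_simps)
    then show "cis (pi * (of_int p * (real r)\<^sup>2 - real r * of_int (int n)) / real b) = cis (pi * of_int p * (real r)\<^sup>2 / real b) * cis (- (pi * real r / real b)) ^ n"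
      by (simp only: Complex.DeMoivre cis_mult)
  qed
  also have "\<dots> = (\<Sum>r<2*b. if r = 0 then 2 * of_nat b else 0)"
    unfolding sum_distrib_left[symmetric] by (intro sum.cong refl) (simp add: inner)
  also have "\<dots> = 2 * of_nat b" using b by simp
  finally show ?thesis .
qed

lemma csqrt_i_mult_of_real: "s > 0 \<Longrightarrow> csqrt (\<i> * of_real s) = of_real (sqrt s) * cis (pi / 4)"
proof -
  assume s: "s > 0"
  have "csqrt ((of_real (sqrt s) * cis (pi / 4))\<^sup>2) = of_real (sqrt s) * cis (pi / 4)"
    using s by (intro csqrt_square) (simp add: cos_45)
  moreover have "(of_real (sqrt s) * cis (pi / 4))\<^sup>2 = \<i> * of_real s"
  proof -
    have "(cis (pi / 4))\<^sup>2 = cis (real 2 * (pi / 4))" by (rule Complex.DeMoivre)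
    also have "\<dots> = \<i>" by simp
    finally show ?thesis using s by (simp add: power_mult_distrib flip: of_real_power)
  qed
  ultimately show ?thesis by simp
qed

lemma norm_comb_weight_le:
  assumes b: "b > 0" and s: "s > 0"
  shows "norm (comb_weight b p s n) \<le> sqrt s"
proof -
  have "norm (comb_weight b p s n) = s / (2 * real b) / sqrt s * norm (gauss_sum b p n)"
    using b s by (simp add: comb_weight_def norm_mult norm_divide csqrt_i_mult_of_real)
  also have "\<dots> \<le> s / (2 * real b) / sqrt s * (2 * real b)"
    using b s by (intro mult_left_mono norm_gauss_sum_le) auto
  also have "\<dots> = sqrt s" using b s by (simp add: real_div_sqrt)
  finally show ?thesis .
qed

text \<open>
  The lattice points \<open>hn\<close> with \<open>n = 2bm + r\<close> are \<open>s(m + r/(2b))\<close>.  In each class the quadratic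
  exponential sum is \<open>F Y + O(1)\<close> with \<open>Y = X/s\<close>, the same main term for all classes, and the
  coefficients \<open>G(r)\<close> of these main terms add up to \<open>2b\<close>.
\<close>
lemma sum_comb_weight:
  assumes b: "b > 0" and s: "s > 0" and q: "q = of_int p / real b" "q > 0"
    and X: "X \<ge> 0" and small: "pi * q * s\<^sup>2 * (2 * (X / s) + 3) \<le> 1"
  shows "norm ((\<Sum>n | s / (2 * real b) * of_int n \<in> {0..X}. comb_weight b p s n) - 
     cis (- pi / 4) * fresnel (sqrt q * X) / of_real (sqrt s * sqrt q)) \<le> 10 * real b * sqrt s"
proof -
  define h where "h = s / (2 * real b)"
  define \<kappa> where "\<kappa> = pi * q * s\<^sup>2"
  define Y where "Y = X / s"
  define \<rho> where "\<rho> = (\<lambda>r::nat. real r / (2 * real b))"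
  define A where "A = of_real h / csqrt (\<i> * of_real s)"
  \<comment> \<open>the primitive of \<open>cis (\<kappa>t\<^sup>2)\<close> that vanishes at \<open>0\<close>\<close>
  define F where "F = (\<lambda>t. fresnel (sqrt q * s * t) / of_real (sqrt q * s))"
  have \<kappa>: "\<kappa> > 0" using q(2) s by (simp add: \<kappa>_def)
  have F: "(F has_vector_derivative cis (\<kappa> * t\<^sup>2)) (at t)" for t
  proof -
    have "((\<lambda>t. sqrt q * s * t) has_vector_derivative sqrt q * s) (at t)"
      unfolding has_real_derivative_iff_has_vector_derivative[symmetric]
      by (auto intro!: derivative_eq_intros)
    from vector_diff_chain_at[OF this fresnel_has_vector_derivative]
    have "((\<lambda>t. fresnel (sqrt q * s * t)) has_vector_derivative (sqrt q * s) *\<^sub>R cis (pi * (sqrt q * s * t)\<^sup>2)) (at t)"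
      by (simp add: o_def)
    then have "(F has_vector_derivative ((sqrt q * s) *\<^sub>R cis (pi * (sqrt q * s * t)\<^sup>2)) / of_real (sqrt q * s)) (at t)"
      unfolding F_def by (rule has_vector_derivative_divide)
    moreover have "pi * (sqrt q * s * t)\<^sup>2 = \<kappa> * t\<^sup>2" using q(2) by (simp add: \<kappa>_def power_mult_distrib)
    ultimately show ?thesis using q(2) s by (simp add: scaleR_conv_of_real)
  qed
  have split: "(\<Sum>n | h * of_int n \<in> {0..X}. comb_weight b p s n) =
     (\<Sum>r<2*b. \<Sum>m | real m + \<rho> r \<le> Y. comb_weight b p s (int r + 2 * int b * int m))"
  proof -
    have fin: "finite {m. real m + \<rho> r \<le> Y}" for r
    proof (rule finite_subset)
      show "{m. real m + \<rho> r \<le> Y} \<subseteq> {..nat \<lfloor>Y\<rfloor>}"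
      proof
        fix m assume "m \<in> {m. real m + \<rho> r \<le> Y}"
        then have "real m + \<rho> r \<le> Y" by simp
        moreover have "0 \<le> \<rho> r" by (simp add: \<rho>_def)
        ultimately have "real m \<le> Y" by linarith
        then show "m \<in> {..nat \<lfloor>Y\<rfloor>}" by (simp add: le_nat_floor)
      qed
    qed simp
    have "(\<Sum>r<2*b. \<Sum>m | real m + \<rho> r \<le> Y. comb_weight b p s (int r + 2 * int b * int m)) =
      (\<Sum>(r, m)\<in>(SIGMA r:{..<2*b}. {m. real m + \<rho> r \<le> Y}). comb_weight b p s (int r + 2 * int b * int m))"
      using fin by (subst sum.Sigma) auto
    also have "\<dots> = (\<Sum>n | h * of_int n \<in> {0..X}. comb_weight b p s n)"
    proof (rule sum.reindex_bij_witness[of _ "\<lambda>n. (nat (n mod (2 * int b)), nat (n div (2 * int b)))" "\<lambda>(r, m). int r + 2 * int b * int m"])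
      fix z assume z: "z \<in> (SIGMA r:{..<2*b}. {m. real m + \<rho> r \<le> Y})"
      obtain r m where rm: "z = (r, m)" "r < 2 * b" "real m + \<rho> r \<le> Y" using z by (cases z) auto
      have 1: "(int r + 2 * int b * int m) mod (2 * int b) = int r" using rm by simp
      have 2: "(int r + 2 * int b * int m) div (2 * int b) = int m" using rm b by simp
      show "(nat ((case z of (r, m) \<Rightarrow> int r + 2 * int b * int m) mod (2 * int b)), nat ((case z of (r, m) \<Rightarrow> int r + 2 * int b * int m) div (2 * int b))) = z"
        unfolding rm(1) case_prod_conv 1 2 by simp
      have "h * of_int (int r + 2 * int b * int m) = s * (real m + \<rho> r)"
        using b by (simp add: h_def \<rho>_def field_simps)
      moreover have "s * (real m + \<rho> r) \<le> X" using rm(3) s by (simp add: Y_def field_simps)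
      moreover have "0 \<le> s * (real m + \<rho> r)" using s by (simp add: \<rho>_def)
      ultimately show "(case z of (r, m) \<Rightarrow> int r + 2 * int b * int m) \<in> {n. h * of_int n \<in> {0..X}}"
        by (simp add: rm)
    next
      fix n assume "n \<in> {n. h * of_int n \<in> {0..X}}"
      then have n: "0 \<le> h * of_int n" "h * of_int n \<le> X" by auto
      have "h > 0" using b s by (simp add: h_def)
      then have "n \<ge> 0" using n(1) by (simp add: zero_le_mult_iff)
      then have 1: "int (nat (n mod (2 * int b))) = n mod (2 * int b)" "int (nat (n div (2 * int b))) = n div (2 * int b)"
        using b by (simp_all add: pos_imp_zdiv_nonneg_iff)
      show eq: "(case (nat (n mod (2 * int b)), nat (n div (2 * int b))) of (r, m) \<Rightarrow> int r + 2 * int b * int m) = n"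
        unfolding case_prod_conv 1 by simp
      define r m where "r = nat (n mod (2 * int b))" and "m = nat (n div (2 * int b))"
      have nrm: "n = int r + 2 * int b * int m" using eq by (simp add: r_def m_def)
      have "s * (real m + \<rho> r) = h * of_int n"
        using b by (simp add: nrm h_def \<rho>_def field_simps)
      then have "real m + \<rho> r \<le> Y" using n(2) s by (simp add: Y_def field_simps)
      moreover have "r < 2 * b" using b by (simp add: r_def nat_less_iff)
      ultimately show "(nat (n mod (2 * int b)), nat (n div (2 * int b))) \<in> (SIGMA r:{..<2*b}. {m. real m + \<rho> r \<le> Y})"
        by (simp add: r_def m_def)
    qed auto
    finally show ?thesis by simp
  qed
  have weight: "comb_weight b p s (int r + 2 * int b * int m) = A * gauss_sum b p (int r) * cis (\<kappa> * (real m + \<rho> r)\<^sup>2)" for r m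
  proof -
    have "s / (2 * real b) * of_int (int r + 2 * int b * int m) = s * (real m + \<rho> r)"
      using b by (simp add: \<rho>_def field_simps)
    then have "pi * (of_int p / real b) * (s / (2 * real b) * of_int (int r + 2 * int b * int m))\<^sup>2 = \<kappa> * (real m + \<rho> r)\<^sup>2"
      by (simp add: \<kappa>_def q(1) power_mult_distrib)
    then show ?thesis unfolding comb_weight_def by (simp only: gauss_sum_periodic[OF b] A_def h_def)
  qed
  define Q where "Q = (\<lambda>r. \<Sum>m | real m + \<rho> r \<le> Y. cis (\<kappa> * (real m + \<rho> r)\<^sup>2))"
  have F0: "F 0 = 0" by (simp add: F_def fresnel_0)
  have Q: "norm (Q r - F Y) \<le> 5" if "r < 2 * b" for r
    using quadratic_exponential_sum[OF F \<kappa>, of "\<rho> r" Y] that b s X small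
    by (simp add: Q_def F0 \<rho>_def Y_def \<kappa>_def divide_simps)
  have total: "(\<Sum>n | h * of_int n \<in> {0..X}. comb_weight b p s n) = A * (\<Sum>r<2*b. gauss_sum b p (int r) * Q r)"
    unfolding split weight Q_def by (simp add: sum_distrib_left mult.assoc)
  have main: "A * (2 * of_nat b * F Y) = cis (- pi / 4) * fresnel (sqrt q * X) / of_real (sqrt s * sqrt q)"
  proof -
    have Y: "sqrt q * s * Y = sqrt q * X" using s by (simp add: Y_def)
    have inv: "inverse (cis (pi / 4)) = cis (- pi / 4)" by simp
    have hb: "complex_of_real h * (2 * of_nat b) = of_real s"
      using b by (simp add: h_def)
    have "A * (2 * of_nat b * F Y) = (of_real h * (2 * of_nat b)) * inverse (cis (pi / 4)) * fresnel (sqrt q * X) *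
        inverse (of_real (sqrt s)) * inverse (of_real (sqrt q * s))"
      unfolding A_def F_def csqrt_i_mult_of_real[OF s] Y by (simp only: divide_inverse inverse_mult_distrib mult_ac)
    also have "\<dots> = cis (- pi / 4) * fresnel (sqrt q * X) * (of_real s * inverse (of_real (sqrt s)) * inverse (of_real (sqrt q * s)))"
      unfolding hb inv by (simp only: mult_ac)
    also have "of_real s * inverse (of_real (sqrt s)) * inverse (of_real (sqrt q * s)) = inverse (complex_of_real (sqrt s * sqrt q))"
      using s q(2) by (simp add: field_simps)
    finally show ?thesis by (simp only: divide_inverse)
  qed
  have diff: "(\<Sum>n | h * of_int n \<in> {0..X}. comb_weight b p s n) - A * (2 * of_nat b * F Y) = A * (\<Sum>r<2*b. gauss_sum b p (int r) * (Q r - F Y))"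
    unfolding total sum_gauss_sum[OF b, of p, symmetric]
    by (simp only: right_diff_distrib sum_subtractf sum_distrib_right)
  have bound: "norm (\<Sum>r<2*b. gauss_sum b p (int r) * (Q r - F Y)) \<le> (\<Sum>r<2*b. 2 * real b * 5)"
  proof (rule sum_norm_le)
    fix r assume "r \<in> {..<2*b}"
    then show "norm (gauss_sum b p (int r) * (Q r - F Y)) \<le> 2 * real b * 5"
      unfolding norm_mult by (intro mult_mono norm_gauss_sum_le Q) auto
  qed
  have A: "norm A = h / sqrt s" using s b by (simp add: A_def norm_divide norm_mult csqrt_i_mult_of_real h_def)
  have "norm ((\<Sum>n | h * of_int n \<in> {0..X}. comb_weight b p s n) - A * (2 * of_nat b * F Y)) \<le> h / sqrt s * (\<Sum>r<2*b. 2 * real b * 5)"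
    unfolding diff norm_mult A by (rule mult_left_mono[OF bound]) (use s b in \<open>simp add: h_def\<close>)
  also have "\<dots> = 10 * real b * (s / sqrt s)" using b by (simp add: h_def)
  also have "\<dots> = 10 * real b * sqrt s" using s by (simp add: real_div_sqrt)
  finally show ?thesis unfolding main h_def .
qed

text \<open>
  The average over the closed and the open interval differs from the sum over the closed one by half of
  the masses at \<open>0\<close> and possibly at \<open>X\<close>, each of modulus at most \<open>sqrt s\<close>.
\<close>
lemma frft_comb_antideriv_estimate:
  assumes b: "b > 0" and s: "sin (pi * \<alpha> / 2) = s" "s > 0" and q: "q = of_int p / real b" "q > 0"
    and c: "cos (pi * \<alpha> / 2) = q * s"
    and X: "X > 0" and small: "pi * q * s\<^sup>2 * (2 * (X / s) + 3) \<le> 1"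
  shows "norm (frft_comb_antideriv \<alpha> X - cis (- pi / 4) * fresnel (sqrt q * X) / of_real (sqrt s * sqrt q))
    \<le> (10 * real b + 1) * sqrt s"
proof -
  define h where "h = s / (2 * real b)"
  define W where "W = comb_weight b p s"
  have h: "h > 0" using s b by (simp add: h_def)
  define A B where "A = {n::int. h * of_int n \<in> {0..X}}" and "B = {n::int. h * of_int n \<in> {0<..<X}}"
  have fin: "finite A"
  proof (rule finite_subset)
    show "A \<subseteq> {0..\<lfloor>X / h\<rfloor>}"
      using h by (auto simp: A_def zero_le_mult_iff le_floor_iff field_simps)
  qed simp
  have BA: "B \<subseteq> A" by (auto simp: A_def B_def)
  have has_sum: "((\<lambda>n::int. W n * \<phi> (h * of_int n)) has_sum frft_distr \<alpha> dirac_comb \<phi>) UNIV" if "schwartz \<phi>" for \<phi>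
    unfolding W_def h_def using frft_comb_has_sum[OF that b s] c q by simp
  have "frft_comb_antideriv \<alpha> X = (sum W A + sum W B) / 2"
    using X delta_mass_lattice[OF h has_sum, of "{0..X}"] delta_mass_lattice[OF h has_sum, of "{0<..<X}"]
      fin finite_subset[OF BA fin]
    by (simp add: frft_comb_antideriv_def frft_comb_pos_def A_def B_def)
  also have "\<dots> = sum W A - sum W (A - B) / 2"
    unfolding sum_diff[OF fin BA] by (simp add: field_simps)
  finally have eq: "frft_comb_antideriv \<alpha> X = sum W A - sum W (A - B) / 2" .
  have "A - B \<subseteq> {0, \<lfloor>X / h\<rfloor>}"
  proof
    fix n assume "n \<in> A - B"
    then have "h * of_int n = 0 \<or> h * of_int n = X" by (auto simp: A_def B_def)
    then have "n = 0 \<or> X / h = of_int n" using h by (auto simp: field_simps)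
    then show "n \<in> {0, \<lfloor>X / h\<rfloor>}" by auto
  qed
  then have card: "card (A - B) \<le> 2"
    using card_mono[of "{0, \<lfloor>X / h\<rfloor>}" "A - B"] card_insert_le_m1[of 2 "{\<lfloor>X / h\<rfloor>}" 0] by simp
  have "norm (sum W (A - B)) \<le> (\<Sum>n\<in>A - B. sqrt s)"
    unfolding W_def by (rule sum_norm_le) (rule norm_comb_weight_le[OF b s(2)])
  also have "\<dots> \<le> 2 * sqrt s" using card s by (simp add: mult_right_mono)
  finally have 1: "norm (sum W (A - B) / 2) \<le> sqrt s" by (simp add: norm_divide)
  have 2: "norm (sum W A - cis (- pi / 4) * fresnel (sqrt q * X) / of_real (sqrt s * sqrt q)) \<le> 10 * real b * sqrt s"
    unfolding W_def A_def h_def by (rule sum_comb_weight[OF b s(2) q _ small]) (use X in simp)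
  have "norm (frft_comb_antideriv \<alpha> X - cis (- pi / 4) * fresnel (sqrt q * X) / of_real (sqrt s * sqrt q))
    \<le> norm (sum W A - cis (- pi / 4) * fresnel (sqrt q * X) / of_real (sqrt s * sqrt q)) + norm (sum W (A - B) / 2)"
    unfolding eq using norm_triangle_ineq4[of "sum W A - cis (- pi / 4) * fresnel (sqrt q * X) / of_real (sqrt s * sqrt q)" "sum W (A - B) / 2"]
    by (simp add: algebra_simps)
  then show ?thesis using 1 2 by (simp add: algebra_simps)
qed

section \<open>The scaling limit\<close>

lemma fresnel_lipschitz: "norm (fresnel y - fresnel x) \<le> \<bar>y - x\<bar>"
  using norm_diff_le_vector_derivative[OF fresnel_has_vector_derivative, of x y 1] by simp

text \<open>
  The factor \<open>1 / sqrt (sq) - 1\<close> multiplies a value of modulus at most \<open>sqrt q X \<le> sqrt q\<close>, and the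
  product is \<open>1 / sqrt s - sqrt q\<close>.
\<close>
lemma fresnel_rescale:
  assumes "s > 0" "q > 0" "0 \<le> X" "X \<le> 1" "0 \<le> t"
  shows "norm (cis (- pi / 4) * fresnel (sqrt q * X) / of_real (sqrt s * sqrt q) - cis (- pi / 4) * fresnel (sqrt t * X))
    \<le> \<bar>1 / sqrt s - sqrt q\<bar> + \<bar>sqrt q - sqrt t\<bar>"
proof -
  have "cis (- pi / 4) * fresnel (sqrt q * X) / of_real (sqrt s * sqrt q) - cis (- pi / 4) * fresnel (sqrt t * X)
     = cis (- pi / 4) * (of_real (1 / (sqrt s * sqrt q) - 1) * fresnel (sqrt q * X) + (fresnel (sqrt q * X) - fresnel (sqrt t * X)))"
    by (simp add: algebra_simps)
  then have "norm (cis (- pi / 4) * fresnel (sqrt q * X) / of_real (sqrt s * sqrt q) - cis (- pi / 4) * fresnel (sqrt t * X))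
     \<le> \<bar>1 / (sqrt s * sqrt q) - 1\<bar> * norm (fresnel (sqrt q * X)) + norm (fresnel (sqrt q * X) - fresnel (sqrt t * X))"
    using norm_triangle_ineq[of "of_real (1 / (sqrt s * sqrt q) - 1) * fresnel (sqrt q * X)" "fresnel (sqrt q * X) - fresnel (sqrt t * X)"]
    by (simp only: norm_mult norm_cis norm_of_real mult_1)
  also have "\<bar>1 / (sqrt s * sqrt q) - 1\<bar> * norm (fresnel (sqrt q * X)) \<le> \<bar>1 / (sqrt s * sqrt q) - 1\<bar> * sqrt q"
  proof (rule mult_left_mono)
    have "norm (fresnel (sqrt q * X)) \<le> sqrt q * X" using fresnel_lipschitz[of "sqrt q * X" 0] assms by (simp add: fresnel_0)
    also have "\<dots> \<le> sqrt q * 1" using assms by (intro mult_left_mono) auto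
    finally show "norm (fresnel (sqrt q * X)) \<le> sqrt q" by simp
  qed simp
  also have "\<bar>1 / (sqrt s * sqrt q) - 1\<bar> * sqrt q = \<bar>1 / sqrt s - sqrt q\<bar>"
  proof -
    have "\<bar>1 / (sqrt s * sqrt q) - 1\<bar> * sqrt q = \<bar>(1 / (sqrt s * sqrt q) - 1) * sqrt q\<bar>" using assms by (simp add: abs_mult)
    also have "(1 / (sqrt s * sqrt q) - 1) * sqrt q = 1 / sqrt s - sqrt q" using assms by (simp add: field_simps)
    finally show ?thesis .
  qed
  also have "norm (fresnel (sqrt q * X) - fresnel (sqrt t * X)) \<le> \<bar>sqrt q - sqrt t\<bar>"
  proof -
    have "norm (fresnel (sqrt q * X) - fresnel (sqrt t * X)) \<le> \<bar>sqrt q * X - sqrt t * X\<bar>" by (rule fresnel_lipschitz)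
    also have "\<dots> = \<bar>sqrt q - sqrt t\<bar> * X" using assms by (simp add: left_diff_distrib[symmetric] abs_mult)
    also have "\<dots> \<le> \<bar>sqrt q - sqrt t\<bar> * 1" using assms by (intro mult_left_mono) auto
    finally show ?thesis by simp
  qed
  finally show ?thesis by simp
qed

theorem corollary7p10:
  fixes a b :: int and \<alpha> :: "nat \<Rightarrow> real" and N :: nat
  assumes "coprime a b" and "b > 0"
    and "\<And>j. \<alpha> j \<in> {0<..<2}"
    and "\<And>j. cot (pi * \<alpha> j / 2) = (of_int a + real j * of_int b) / of_int b"
    and "N > 0"
  shows "(\<lambda>j. SUP X \<in> {0..real j powr (- 1 / (2 * real N))}.
            ereal (cmod (frft_comb_antideriv (\<alpha> j) X
                         - exp (- (of_real pi * \<i> / 4)) * fresnel (real j powr (1 / 2) * X))))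
         \<longlonglongrightarrow> 0"
proof -
  define c where "c = of_int a / (of_int b :: real)"
  define q where "q = (\<lambda>j. c + real j)"
  define s where "s = (\<lambda>j. 1 / sqrt (1 + (c + real j)\<^sup>2))"
  define R where "R = (\<lambda>j. real j powr (- 1 / (2 * real N)))"
  define err where "err = (\<lambda>j. (10 * of_int b + 1) * sqrt (s j) + (\<bar>1 / sqrt (s j) - sqrt (q j)\<bar> + \<bar>sqrt (q j) - sqrt (real j)\<bar>))"
  let ?d = "\<lambda>j X. cmod (frft_comb_antideriv (\<alpha> j) X - exp (- (of_real pi * \<i> / 4)) * fresnel (real j powr (1 / 2) * X))"
  have s0: "s j > 0" for j by (simp add: s_def add_pos_nonneg)
  have trig: "sin (pi * \<alpha> j / 2) = s j" "cos (pi * \<alpha> j / 2) = q j * s j" for j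
  proof -
    have "0 < pi * \<alpha> j / 2" "pi * \<alpha> j / 2 < pi" using assms(3)[of j] by (auto simp: field_simps)
    then have sin: "sin (pi * \<alpha> j / 2) > 0" by (rule sin_gt_zero)
    have "cot (pi * \<alpha> j / 2) = q j" using assms(2) unfolding assms(4) q_def c_def by (simp add: field_simps)
    then have cos: "cos (pi * \<alpha> j / 2) = q j * sin (pi * \<alpha> j / 2)" using sin by (simp add: cot_def field_simps)
    have "(sin (pi * \<alpha> j / 2))\<^sup>2 * (1 + (q j)\<^sup>2) = 1"
      using sin_cos_squared_add[of "pi * \<alpha> j / 2"] unfolding cos by (simp add: power_mult_distrib algebra_simps)
    then have "sqrt ((sin (pi * \<alpha> j / 2))\<^sup>2 * (1 + (q j)\<^sup>2)) = 1" by simp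
    then have "sin (pi * \<alpha> j / 2) * sqrt (1 + (q j)\<^sup>2) = 1" using sin by (simp add: real_sqrt_mult)
    moreover have "s j * sqrt (1 + (q j)\<^sup>2) = 1"
      by (simp add: s_def q_def add_nonneg_eq_0_iff)
    moreover have "sqrt (1 + (q j)\<^sup>2) \<noteq> 0" by (simp add: add_nonneg_eq_0_iff)
    ultimately show "sin (pi * \<alpha> j / 2) = s j" by (metis mult_right_cancel)
    then show "cos (pi * \<alpha> j / 2) = q j * s j" using cos by simp
  qed
  have R: "R \<longlonglongrightarrow> 0"
    unfolding R_def by (rule tendsto_neg_powr[OF _ filterlim_real_sequentially]) (use assms(5) in simp)
  have s: "s \<longlonglongrightarrow> 0" unfolding s_def by real_asymp
  have err: "err \<longlonglongrightarrow> 0"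
  proof -
    have 1: "(\<lambda>j. \<bar>1 / sqrt (s j) - sqrt (q j)\<bar>) \<longlonglongrightarrow> 0"
      unfolding s_def q_def by (intro tendsto_rabs_zero) real_asymp
    have 2: "(\<lambda>j. \<bar>sqrt (q j) - sqrt (real j)\<bar>) \<longlonglongrightarrow> 0"
      unfolding q_def by (intro tendsto_rabs_zero) real_asymp
    have 3: "(\<lambda>j. (10 * of_int b + 1) * sqrt (s j)) \<longlonglongrightarrow> 0"
      using tendsto_real_sqrt[OF s] by (intro tendsto_mult_right_zero) simp
    show ?thesis
      unfolding err_def using tendsto_add[OF 3 tendsto_add[OF 1 2]] by simp
  qed
  have ev: "\<forall>\<^sub>F j in sequentially. \<forall>X\<in>{0..R j}. ?d j X \<le> err j"
  proof -
    have "(\<lambda>j. 2 * pi * R j + 3 * pi * s j) \<longlonglongrightarrow> 2 * pi * 0 + 3 * pi * 0"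
      by (intro tendsto_intros R s)
    then have "\<forall>\<^sub>F j in sequentially. 2 * pi * R j + 3 * pi * s j < 1"
      by (rule order_tendstoD) simp
    moreover have "\<forall>\<^sub>F j in sequentially. q j > 0"
      unfolding q_def by real_asymp
    moreover have "\<forall>\<^sub>F j in sequentially. R j < 1" using R by (rule order_tendstoD) simp
    ultimately show ?thesis
    proof eventually_elim
      case (elim j)
      show ?case
      proof
        fix X assume X: "X \<in> {0..R j}"
        show "?d j X \<le> err j"
        proof (cases "X = 0")
          case True
          have "0 \<le> err j" unfolding err_def using s0[of j] assms(2) by (intro add_nonneg_nonneg mult_nonneg_nonneg) auto
          then show ?thesis using True by (simp add: frft_comb_antideriv_def fresnel_0)
        next
          case False
          then have X0: "0 < X" "X \<le> R j" using X by auto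
          \<comment> \<open>the product is a cosine\<close>
          have qs: "q j * s j \<le> 1" using cos_le_one[of "pi * \<alpha> j / 2"] trig by simp
          have "pi * q j * (s j)\<^sup>2 * (2 * (X / s j) + 3) = q j * s j * (2 * pi * X + 3 * pi * s j)"
            using s0[of j] by (simp add: field_simps power2_eq_square)
          also have "\<dots> \<le> 1 * (2 * pi * X + 3 * pi * s j)"
            using qs X0 s0[of j] by (intro mult_right_mono) (auto simp: add_nonneg_nonneg)
          also have "\<dots> \<le> 2 * pi * R j + 3 * pi * s j" using X0 by simp
          also have "\<dots> \<le> 1" using elim by simp
          finally have small: "pi * q j * (s j)\<^sup>2 * (2 * (X / s j) + 3) \<le> 1" .
          have qp: "q j = of_int (a + int j * b) / real (nat b)"
            using assms(2) by (simp add: q_def c_def field_simps)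
          let ?M = "cis (- pi / 4) * fresnel (sqrt (q j) * X) / of_real (sqrt (s j) * sqrt (q j))"
          have "norm (frft_comb_antideriv (\<alpha> j) X - ?M) \<le> (10 * real (nat b) + 1) * sqrt (s j)"
            by (rule frft_comb_antideriv_estimate[OF _ trig(1) s0 qp _ trig(2) X0(1) small]) (use elim assms(2) in auto)
          moreover have "norm (?M - cis (- pi / 4) * fresnel (sqrt (real j) * X))
             \<le> \<bar>1 / sqrt (s j) - sqrt (q j)\<bar> + \<bar>sqrt (q j) - sqrt (real j)\<bar>"
            by (rule fresnel_rescale) (use elim X0 s0 in auto)
          ultimately have "norm ((frft_comb_antideriv (\<alpha> j) X - ?M) + (?M - cis (- pi / 4) * fresnel (sqrt (real j) * X))) 
             \<le> (10 * real (nat b) + 1) * sqrt (s j) + (\<bar>1 / sqrt (s j) - sqrt (q j)\<bar> + \<bar>sqrt (q j) - sqrt (real j)\<bar>)"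
            by (rule norm_triangle_mono)
          moreover have "(frft_comb_antideriv (\<alpha> j) X - ?M) + (?M - cis (- pi / 4) * fresnel (sqrt (real j) * X))
             = frft_comb_antideriv (\<alpha> j) X - exp (- (of_real pi * \<i> / 4)) * fresnel (real j powr (1 / 2) * X)"
          proof -
            have "exp (- (of_real pi * \<i> / 4)) = cis (- pi / 4)" by (simp add: cis_conv_exp mult_ac)
            moreover have "real j powr (1 / 2) = sqrt (real j)" by (simp add: powr_half_sqrt)
            ultimately show ?thesis by (simp only: diff_add_cancel diff_add_eq_diff_diff_swap add_diff_eq)
          qed
          moreover have "real (nat b) = of_int b" using assms(2) by simp
          ultimately show ?thesis unfolding err_def by (simp only:)
        qed
      qed
    qed
  qed
  have "(\<lambda>j. SUP X\<in>{0..R j}. ereal (?d j X)) \<longlonglongrightarrow> 0"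
  proof (rule tendsto_sandwich)
    show "\<forall>\<^sub>F j in sequentially. 0 \<le> (SUP X\<in>{0..R j}. ereal (?d j X))"
    proof (intro always_eventually allI)
      fix j
      have "0 \<in> {0..R j}" by (simp add: R_def)
      then show "0 \<le> (SUP X\<in>{0..R j}. ereal (?d j X))" by (rule SUP_upper2) simp
    qed
    show "\<forall>\<^sub>F j in sequentially. (SUP X\<in>{0..R j}. ereal (?d j X)) \<le> ereal (err j)"
      using ev
    proof eventually_elim
      case (elim j)
      then show ?case by (intro SUP_least) simp
    qed
    show "(\<lambda>j. ereal (err j)) \<longlonglongrightarrow> 0"
      using err by (simp add: zero_ereal_def)
  qed simp
  then show ?thesis unfolding R_def .
qed

end
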